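(* Along the phase transition curve near the critical point $(\rho_c,\beta_c)$, the two optimizers $a_1<a_c<a_2$ satisfy, as $\beta\to\beta_c$, $$a_2-a_1\simeq 2D_c\left(\frac{\rho_c}{\sqrt{\beta_c}}\sqrt{\log\frac{1+e^{a_c}}{1+\rho_c}}\right)^{1/2}|\beta-\beta_c|^{1/2},$$ where $$D_c=\left(\frac{1}{\left(\log\frac{1+e^{a_c}}{1+\rho_c}\right)^{3/2}}\ \frac{3e^{a_c}}{\rho_c(1+e^{a_c})}\ \frac{1}{\frac{\partial^3}{\partial a^3}F(a_c;\rho_c)}\right)^{1/2}.$$ Therefore the critical exponent is $1/2$.
   Context: For $\rho>0$ and $a>\log\rho$ let $$F(a;\rho)=\int_{\log\rho}^{a}\frac{dx}{\sqrt{\log\frac{1+e^a}{1+e^x}}}.$$ For $\rho,\beta>0$ the Lyapunov exponent $\lambda(\rho,\beta)$ (the limit of $\frac1n\log\mathbb{E}[x_n]$ at fixed $\beta=\frac12\sigma^2\tau n^2$ for $x_{i+1}=x_i(1+\rho e^{\sigma W(i\tau)-\frac12\sigma^2 i\tau})$, $x_0>0$, $W$ a standard Brownian motion) equals $$\lambda(\rho,\beta)=\sup_{a}\left\{\log(1+e^a)-\frac1{\sqrt\beta}\int_{\log\rho}^a\sqrt{\log\frac{1+e^a}{1+e^x}}\,dx\right\},$$ and optimal values of $a$ satisfy $F(a;\rho)=2\sqrt\beta$. Critical point: $\rho_c=\sup\{\rho:\exists a,\ \partial_aF(a;\rho)<0\}\in(0,\infty)$, $a_c$ is such that $\partial_aF(a_c;\rho_c)=0$,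 and $\beta_c$ is defined by $2\sqrt{\beta_c}=F(a_c;\rho_c)$. At the critical point $\partial_aF(a_c;\rho_c)=\partial_a^2F(a_c;\rho_c)=0$ and $\partial_a^3F(a_c;\rho_c)>0$. Phase transition curve: the set of $(\rho,\beta)$ at which the supremum above is attained at two distinct values $a_1<a_2$ (so $F(a_1;\rho)=F(a_2;\rho)=2\sqrt\beta$). It is taken to be a smooth curve ending at $(\rho_c,\beta_c)$, with $a_1<a_c<a_2$ and $a_1,a_2\to a_c$ as $(\rho,\beta)\to(\rho_c,\beta_c)$ along it. The symbol $\simeq$ means that the ratio of the two sides tends to $1$. If $a_2-a_1\simeq\gamma|\beta-\beta_c|^{\alpha}$ along the phase transition curve as $\beta\to\beta_c$, then $\alpha$ is called the critical exponent. *)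

theory Defs
  imports "HOL-Analysis.Analysis" "HOL-Library.Landau_Symbols"
begin

definition F :: "real \<Rightarrow> real \<Rightarrow> real" where
  "F a \<rho> = integral {ln \<rho>..a} (\<lambda>x. 1 / sqrt (ln ((1 + exp a) / (1 + exp x))))"

definition objective :: "real \<Rightarrow> real \<Rightarrow> real \<Rightarrow> real" where
  "objective \<rho> \<beta> a =
     ln (1 + exp a) - 1 / sqrt \<beta> * integral {ln \<rho>..a} (\<lambda>x. sqrt (ln ((1 + exp a) / (1 + exp x))))"

(* The variational formula for the Lyapunov exponent; the supremum is finite by
   bdd_above_objective below. *)
definition lyapunov :: "real \<Rightarrow> real \<Rightarrow> real" where
  "lyapunov \<rho> \<beta> = (SUP a\<in>{ln \<rho><..}. objective \<rho> \<beta> a)"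

definition optimizer :: "real \<Rightarrow> real \<Rightarrow> real \<Rightarrow> bool" where
  "optimizer \<rho> \<beta> a \<longleftrightarrow> ln \<rho> < a \<and> objective \<rho> \<beta> a = lyapunov \<rho> \<beta>"

definition phase_transition_curve :: "(real \<times> real) set" where
  "phase_transition_curve =
     {(\<rho>, \<beta>). 0 < \<rho> \<and> 0 < \<beta> \<and> (\<exists>a\<^sub>1 a\<^sub>2. a\<^sub>1 < a\<^sub>2 \<and> optimizer \<rho> \<beta> a\<^sub>1 \<and> optimizer \<rho> \<beta> a\<^sub>2)}"

definition nonmonotone_rhos :: "real set" where
  "nonmonotone_rhos = {\<rho>. 0 < \<rho> \<and> (\<exists>a>ln \<rho>. deriv (\<lambda>a. F a \<rho>) a < 0)}"

(* The first two conjuncts say that the supremum lies in (0, \<infinity>). *)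
definition critical_point :: "real \<Rightarrow> real \<Rightarrow> real \<Rightarrow> bool" where
  "critical_point \<rho> a \<beta> \<longleftrightarrow>
     nonmonotone_rhos \<noteq> {} \<and> bdd_above nonmonotone_rhos \<and>
     \<rho> = Sup nonmonotone_rhos \<and>
     ln \<rho> < a \<and> deriv (\<lambda>a. F a \<rho>) a = 0 \<and>
     0 < \<beta> \<and> 2 * sqrt \<beta> = F a \<rho>"

(* A regular, injectively parametrised C-infinity curve on an open interval; only convergence,
   not smoothness, is required at the end point p, which does not belong to C. *)
definition smooth_curve_ending_at :: "(real \<times> real) set \<Rightarrow> real \<times> real \<Rightarrow> bool" where
  "smooth_curve_ending_at C p \<longleftrightarrow>
     (\<exists>x y :: real \<Rightarrow> real.
        C = (\<lambda>t. (x t, y t)) ` {0<..<1} \<and> inj_on (\<lambda>t. (x t, y t)) {0<..<1} \<and>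
        (\<forall>n. \<forall>t\<in>{0<..<1}. (deriv ^^ n) x field_differentiable at t \<and>
                          (deriv ^^ n) y field_differentiable at t) \<and>
        (\<forall>t\<in>{0<..<1}. (deriv x t, deriv y t) \<noteq> (0, 0)) \<and>
        p \<notin> C \<and> ((\<lambda>t. (x t, y t)) \<longlongrightarrow> p) (at_right 0))"

definition D\<^sub>c :: "real \<Rightarrow> real \<Rightarrow> real" where
  "D\<^sub>c \<rho> a = sqrt (1 / ln ((1 + exp a) / (1 + \<rho>)) powr (3/2)
              * (3 * exp a / (\<rho> * (1 + exp a)))
              * (1 / (deriv ^^ 3) (\<lambda>a. F a \<rho>) a))"

definition is_critical_exponent ::
    "real \<Rightarrow> real \<Rightarrow> (real \<times> real \<Rightarrow> real) \<Rightarrow> (real \<times> real \<Rightarrow> real) \<Rightarrow> real \<Rightarrow> bool" where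
  "is_critical_exponent \<rho>\<^sub>c \<beta>\<^sub>c a\<^sub>1 a\<^sub>2 \<alpha> \<longleftrightarrow>
     (\<exists>\<gamma>. (\<lambda>p. a\<^sub>2 p - a\<^sub>1 p) \<sim>[at (\<rho>\<^sub>c, \<beta>\<^sub>c) within phase_transition_curve]
            (\<lambda>p. \<gamma> * \<bar>snd p - \<beta>\<^sub>c\<bar> powr \<alpha>))"

lemma integral_objective_lower:
  assumes "0 < \<rho>" "ln \<rho> < a"
  shows "sqrt (\<rho> / (1 + \<rho>)) * (((a - ln \<rho>) / 2) * sqrt ((a - ln \<rho>) / 2))
          \<le> integral {ln \<rho>..a} (\<lambda>x. sqrt (ln ((1 + exp a) / (1 + exp x))))"
proof -
  define c where "c = ln \<rho>"
  define m where "m = (c + a) / 2"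
  have cm: "c < m" "m < a" using assms unfolding m_def c_def by auto
  have ec: "exp c = \<rho>" using assms by (simp add: c_def)
  let ?f = "\<lambda>x. sqrt (ln ((1 + exp a) / (1 + exp x)))"
  have pos: "1 + exp (x::real) > 0" for x by (simp add: add_pos_pos)
  have cont: "continuous_on {c..a} ?f"
    using pos by (intro continuous_intros) (auto simp: less_imp_neq[symmetric])
  have int: "?f integrable_on {c..a}" by (rule integrable_continuous_real[OF cont])
  have int1: "?f integrable_on {c..m}"
    by (rule integrable_subinterval_real[OF int]) (use cm in auto)
  have nonneg: "0 \<le> ?f x" if "x \<in> {c..a}" for x
    using that pos[of x] by (intro real_sqrt_ge_zero ln_ge_zero) (auto simp: field_simps)
  have slope: "\<rho> / (1 + \<rho>) * (a - x) \<le> ln ((1 + exp a) / (1 + exp x))" if x: "c \<le> x" "x \<le> a" for x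
  proof -
    have "ln (1 + exp x) - \<rho> / (1 + \<rho>) * x \<le> ln (1 + exp a) - \<rho> / (1 + \<rho>) * a"
    proof (rule DERIV_nonneg_imp_nondecreasing[OF x(2)])
      fix t assume t: "x \<le> t" "t \<le> a"
      have "\<rho> \<le> exp t" using ec t x by (metis exp_le_cancel_iff order_trans)
      then have "\<rho> * (1 + exp t) \<le> exp t * (1 + \<rho>)" by (simp add: algebra_simps)
      moreover have "0 < 1 + \<rho>" using assms by simp
      ultimately have "\<rho> / (1 + \<rho>) \<le> exp t / (1 + exp t)"
        using pos[of t] by (simp only: pos_divide_le_eq pos_le_divide_eq times_divide_eq_left)
      then show "\<exists>y. ((\<lambda>x. ln (1 + exp x) - \<rho> / (1 + \<rho>) * x) has_real_derivative y) (at t) \<and> 0 \<le> y"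
        using pos[of t] \<open>0 < 1 + \<rho>\<close>
        by (intro exI[of _ "exp t / (1 + exp t) - \<rho> / (1 + \<rho>)"] conjI)
           (auto intro!: derivative_eq_intros)
    qed
    then show ?thesis using pos[of a] pos[of x] by (simp add: ln_div right_diff_distrib)
  qed
  have "(m - c) * sqrt (\<rho> / (1 + \<rho>) * (a - m)) = integral {c..m} (\<lambda>x. sqrt (\<rho> / (1 + \<rho>) * (a - m)))"
    using cm by simp
  also have "\<dots> \<le> integral {c..m} ?f"
  proof (rule integral_le[OF _ int1])
    fix x assume x: "x \<in> {c..m}"
    have "\<rho> / (1 + \<rho>) * (a - m) \<le> \<rho> / (1 + \<rho>) * (a - x)"
      using x assms by (intro mult_left_mono) auto
    also have "\<dots> \<le> ln ((1 + exp a) / (1 + exp x))" using slope[of x] x cm by auto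
    finally show "sqrt (\<rho> / (1 + \<rho>) * (a - m)) \<le> ?f x" by (rule real_sqrt_le_mono)
  qed auto
  also have "\<dots> \<le> integral {c..a} ?f"
    by (rule integral_subset_le[OF _ int1 int]) (use cm nonneg in auto)
  finally have "(m - c) * (sqrt (\<rho> / (1 + \<rho>)) * sqrt (a - m)) \<le> integral {c..a} ?f"
    by (simp only: real_sqrt_mult)
  moreover have "m - c = (a - ln \<rho>) / 2" "a - m = (a - ln \<rho>) / 2"
    unfolding m_def c_def by (simp_all add: field_simps)
  ultimately show ?thesis by (simp only: c_def mult.left_commute)
qed

lemma bdd_above_objective:
  assumes "0 < \<rho>" "0 < \<beta>"
  shows "bdd_above (objective \<rho> \<beta> ` {ln \<rho><..})"
proof -
  define K where "K = sqrt (\<rho> / (1 + \<rho>)) / sqrt \<beta>"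
  have K: "K > 0" using assms by (simp add: K_def)
  have "objective \<rho> \<beta> a \<le> ln (1 + 1/\<rho>) + ln \<rho> + 8 / K ^ 2" if a: "ln \<rho> < a" for a
  proof -
    define s where "s = (a - ln \<rho>) / 2"
    define r where "r = sqrt s"
    have s: "s > 0" "s = r ^ 2" "r > 0" using a by (auto simp: s_def r_def)
    have a_eq: "a = ln \<rho> + 2 * r ^ 2" using s(2) by (simp add: s_def field_simps)
    have ea: "\<rho> \<le> exp a" using a assms by (metis exp_le_cancel_iff exp_ln less_imp_le)
    have "1 + exp a \<le> (1 + 1/\<rho>) * exp a" using ea assms by (simp add: field_simps)
    then have "ln (1 + exp a) \<le> ln ((1 + 1/\<rho>) * exp a)"
      using add_pos_pos[OF zero_less_one exp_gt_zero[of a]] by (intro ln_mono) auto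
    also have "\<dots> = ln (1 + 1/\<rho>) + a" using assms by (subst ln_mult_pos) (auto intro: add_pos_pos)
    finally have 1: "ln (1 + exp a) \<le> ln (1 + 1/\<rho>) + a" .
    have "K * (s * sqrt s) = 1 / sqrt \<beta> * (sqrt (\<rho> / (1 + \<rho>)) * (s * sqrt s))"
      by (simp add: K_def)
    also have "\<dots> \<le> 1 / sqrt \<beta> * integral {ln \<rho>..a} (\<lambda>x. sqrt (ln ((1 + exp a) / (1 + exp x))))"
      using integral_objective_lower[OF assms(1) a] assms unfolding s_def
      by (intro mult_left_mono) auto
    finally have K_le: "K * (s * sqrt s) \<le> 1 / sqrt \<beta> * integral {ln \<rho>..a} (\<lambda>x. sqrt (ln ((1 + exp a) / (1 + exp x))))" .
    have 2: "objective \<rho> \<beta> a \<le> ln (1 + 1/\<rho>) + ln \<rho> + (2 * r ^ 2 - K * r ^ 3)"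
    proof -
      have "s * sqrt s = r ^ 2 * r" unfolding r_def[symmetric] using s(2) by (rule arg_cong)
      then have "s * sqrt s = r ^ 3" by (simp only: power2_eq_square power3_eq_cube)
      with K_le have "K * r ^ 3 \<le> ln (1 + exp a) - objective \<rho> \<beta> a"
        by (simp add: objective_def)
      with 1 a_eq show ?thesis by linarith
    qed
    have "2 * r ^ 2 - K * r ^ 3 \<le> 8 / K ^ 2"
    proof (cases "K * r \<le> 2")
      case True
      then have "(K * r) ^ 2 \<le> 2 ^ 2" using K s by (intro power_mono) auto
      then have "2 * r ^ 2 \<le> 8 / K ^ 2" using K by (simp add: field_simps power_mult_distrib)
      moreover have "K * r ^ 3 \<ge> 0" using K s by simp
      ultimately show ?thesis by linarith
    next
      case False
      then have "2 * r ^ 2 \<le> (K * r) * r ^ 2" using s by (intro mult_right_mono) auto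
      then have "2 * r ^ 2 - K * r ^ 3 \<le> 0" by (simp add: power2_eq_square power3_eq_cube)
      also have "0 \<le> 8 / K ^ 2" by simp
      finally show ?thesis .
    qed
    with 2 show ?thesis by linarith
  qed
  then show ?thesis by (intro bdd_aboveI2) auto
qed

end

theory Submission
  imports Defs
begin

text \<open>
  The objective has derivative \<open>logistic a * (1 - F a \<rho> / (2 * sqrt \<beta>))\<close> in \<open>a\<close>
  (\<open>DERIV_objective\<close>).  Two optimizers \<open>a\<^sub>1 < a\<^sub>2\<close> are therefore two points where the graph of
  \<open>F\<close> at fixed \<open>\<rho>\<close> crosses the level \<open>2 * sqrt \<beta>\<close>, and, since the objective takes the same value
  at both, the area enclosed between the graph and this level from \<open>a\<^sub>1\<close> to \<open>a\<^sub>2\<close>, weighted by the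
  positive function \<open>logistic\<close>, vanishes: Maxwell's equal-area rule (\<open>optimizers_equal_area\<close>).

  Put \<open>h = a - a\<^sub>c\<close> and \<open>s = ln \<rho> - ln \<rho>\<^sub>c\<close>.  Near the critical point \<open>F\<close> is, up to relatively small
  errors, its value at \<open>a\<^sub>c\<close> plus \<open>q * s * h + \<tau> * h ^ 3\<close>, where \<open>\<tau>\<close> is a sixth of the third derivative
  and \<open>q > 0\<close> is the mixed derivative of \<open>F\<close> in \<open>ln \<rho>\<close> and \<open>a\<close> (\<open>F_expansion\<close>).  The trapezoidal
  rule integrates a cubic exactly only over an interval that is symmetric about its inflection point,
  so for a cubic the equal-area rule forces \<open>a\<^sub>1 + a\<^sub>2 = 2 * a\<^sub>c\<close>, after which
  \<open>q * s = - \<tau> * (a\<^sub>2 - a\<^sub>1)\<^sup>2 / 4\<close> and the level passes through the inflection point.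
  The lemma \<open>equal_area_cubic\<close> shows that the errors change these relations only to higher order.
  Hence \<open>2 * sqrt \<beta> = F a\<^sub>c \<rho>\<close> up to \<open>o((a\<^sub>2 - a\<^sub>1)\<^sup>2)\<close>, which makes
  \<open>\<beta> - \<beta>\<^sub>c\<close> asymptotically a negative multiple of \<open>s\<close>; eliminating \<open>s\<close> yields the square-root law
  and its constant.

  The analytic difficulty is that the integrand of \<open>F\<close> is singular at the end point \<open>x = a\<close>, which
  moves with \<open>a\<close>.  The substitution \<open>v\<^sup>2 = softplus a - softplus x\<close>, with \<open>softplus x = ln (1 + exp x)\<close>,
  removes the singularity; after rescaling \<open>v\<close> to the unit interval the parameter occurs only in a smooth
  integrand (\<open>F_scaled\<close>), so that \<open>F\<close> is arbitrarily often differentiable in \<open>a\<close>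
  (\<open>times_differentiable_on_F\<close>).  The dependence on \<open>\<rho>\<close> is harmless: \<open>\<rho>\<close> only moves the lower end
  point, where the integrand is regular (\<open>DERIV_F_ln_rho\<close>).
\<close>

section \<open>Iterated differentiability on the real line\<close>

text \<open>
  Existence of derivatives of all orders up to \<open>n\<close>, phrased with existentially quantified derivatives
  instead of iterated \<open>deriv\<close>: closure properties then follow by plain induction on the order.  At order
  \<open>0\<close> nothing is demanded, not even continuity.
\<close>
primrec times_differentiable_on :: "nat \<Rightarrow> real set \<Rightarrow> (real \<Rightarrow> real) \<Rightarrow> bool" where
  "times_differentiable_on 0 S f \<longleftrightarrow> True"
| "times_differentiable_on (Suc n) S f \<longleftrightarrow>
     (\<exists>f'. (\<forall>x\<in>S. (f has_real_derivative f' x) (at x)) \<and> times_differentiable_on n S f')"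

lemma times_differentiable_on_SucI:
  assumes "\<And>x. x \<in> S \<Longrightarrow> (f has_real_derivative f' x) (at x)" "times_differentiable_on n S f'"
  shows "times_differentiable_on (Suc n) S f"
  unfolding times_differentiable_on.simps using assms by (intro exI[of _ f'] conjI ballI)

lemma times_differentiable_on_SucD:
  "times_differentiable_on (Suc n) S f \<Longrightarrow> times_differentiable_on n S f"
proof (induction n arbitrary: f)
  case (Suc n)
  then show ?case by (metis times_differentiable_on.simps(2))
qed simp

lemma times_differentiable_on_cong:
  assumes "open S" "\<And>x. x \<in> S \<Longrightarrow> f x = g x" "times_differentiable_on n S f"
  shows "times_differentiable_on n S g"
proof (cases n)
  case (Suc k)
  with assms(3) obtain f' where f': "\<forall>x\<in>S. (f has_real_derivative f' x) (at x)"
    "times_differentiable_on k S f'" by auto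
  have "(g has_real_derivative f' x) (at x)" if "x \<in> S" for x
    using has_field_derivative_transform_within_open[of f "f' x" x S g] f'(1) assms(1,2) that by blast
  with f'(2) Suc show ?thesis by auto
qed simp

lemma times_differentiable_on_const: "times_differentiable_on n S (\<lambda>x. c)"
  by (induction n arbitrary: c) (auto intro!: times_differentiable_on_SucI[of _ _ "\<lambda>x. 0"] DERIV_const simp del: times_differentiable_on.simps(2))

lemma times_differentiable_on_add:
  "times_differentiable_on n S f \<Longrightarrow> times_differentiable_on n S g \<Longrightarrow>
   times_differentiable_on n S (\<lambda>x. f x + g x)"
proof (induction n arbitrary: f g)
  case (Suc n)
  then obtain f' g' where *: "\<forall>x\<in>S. (f has_real_derivative f' x) (at x)" "times_differentiable_on n S f'"
    "\<forall>x\<in>S. (g has_real_derivative g' x) (at x)" "times_differentiable_on n S g'" by auto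
  show ?case
    using * Suc.IH by (intro times_differentiable_on_SucI[of _ _ "\<lambda>x. f' x + g' x"] DERIV_add) auto
qed simp

lemma times_differentiable_on_mult:
  "times_differentiable_on n S f \<Longrightarrow> times_differentiable_on n S g \<Longrightarrow>
   times_differentiable_on n S (\<lambda>x. f x * g x)"
proof (induction n arbitrary: f g)
  case (Suc n)
  then obtain f' g' where *: "\<forall>x\<in>S. (f has_real_derivative f' x) (at x)" "times_differentiable_on n S f'"
    "\<forall>x\<in>S. (g has_real_derivative g' x) (at x)" "times_differentiable_on n S g'" by auto
  have "times_differentiable_on n S (\<lambda>x. f' x * g x + g' x * f x)"
    by (rule times_differentiable_on_add[OF Suc.IH[OF *(2) Suc.prems(2)[THEN times_differentiable_on_SucD]]
          Suc.IH[OF *(4) Suc.prems(1)[THEN times_differentiable_on_SucD]]])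
  moreover have "((\<lambda>x. f x * g x) has_real_derivative f' x * g x + g' x * f x) (at x)" if "x \<in> S" for x
    using DERIV_mult *(1,3) that by blast
  ultimately show ?case by (intro times_differentiable_on_SucI) auto
qed simp

lemma times_differentiable_on_compose:
  assumes "\<And>x. x \<in> S \<Longrightarrow> g x \<in> T"
  shows "times_differentiable_on n T f \<Longrightarrow> times_differentiable_on n S g \<Longrightarrow>
   times_differentiable_on n S (\<lambda>x. f (g x))"
proof (induction n arbitrary: f)
  case (Suc n)
  then obtain f' g' where *: "\<forall>x\<in>T. (f has_real_derivative f' x) (at x)" "times_differentiable_on n T f'"
    "\<forall>x\<in>S. (g has_real_derivative g' x) (at x)" "times_differentiable_on n S g'" by auto
  have "times_differentiable_on n S (\<lambda>x. f' (g x) * g' x)"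
    by (rule times_differentiable_on_mult[OF Suc.IH[OF *(2) Suc.prems(2)[THEN times_differentiable_on_SucD]] *(4)])
  moreover have "((\<lambda>x. f (g x)) has_real_derivative f' (g x) * g' x) (at x)" if "x \<in> S" for x
    using DERIV_chain2 *(1,3) that assms by blast
  ultimately show ?case by (intro times_differentiable_on_SucI) auto
qed simp

text \<open>
  A solution of a polynomial differential equation bootstraps its own smoothness.  Both \<open>logistic\<close>
  and \<open>bose\<close> below solve an equation of this quadratic form.
\<close>
lemma times_differentiable_on_logistic_ode:
  assumes "\<And>x. x \<in> S \<Longrightarrow> (f has_real_derivative c * f x + d * (f x * f x)) (at x)"
  shows "times_differentiable_on n S f"
proof (induction n)
  case (Suc n)
  then have "times_differentiable_on n S (\<lambda>x. c * f x + d * (f x * f x))"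
    by (intro times_differentiable_on_add times_differentiable_on_mult times_differentiable_on_const)
  with assms show ?case by (intro times_differentiable_on_SucI)
qed simp

lemma times_differentiable_on_powr:
  "times_differentiable_on n {0<..} (\<lambda>x. x powr r)"
proof (induction n arbitrary: r)
  case (Suc n)
  have "((\<lambda>x. x powr r) has_real_derivative r * x powr (r - 1)) (at x)" if "x > 0" for x :: real
    using that by (auto intro!: derivative_eq_intros)
  moreover have "times_differentiable_on n {0<..} (\<lambda>x. r * x powr (r - 1))"
    by (intro times_differentiable_on_mult times_differentiable_on_const Suc)
  ultimately show ?case by (intro times_differentiable_on_SucI) auto
qed simp

lemma times_differentiable_on_deriv:
  assumes "open S"
  shows "times_differentiable_on (n + k) S f \<Longrightarrow> times_differentiable_on n S ((deriv ^^ k) f)"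
proof (induction k arbitrary: f)
  case (Suc k)
  then obtain f' where f': "\<forall>x\<in>S. (f has_real_derivative f' x) (at x)"
    "times_differentiable_on (n + k) S f'" by auto
  then have "times_differentiable_on (n + k) S (deriv f)"
    using times_differentiable_on_cong[OF assms _ f'(2), of "deriv f"] by (metis DERIV_imp_deriv)
  then show ?case using Suc.IH by (simp add: funpow_swap1)
qed simp

lemma times_differentiable_on_DERIV_deriv:
  assumes "times_differentiable_on (Suc n) S f" "x \<in> S"
  shows "(f has_real_derivative deriv f x) (at x)"
  using assms by (auto simp: DERIV_imp_deriv)

text \<open>
  At a degenerate critical point the graph is cubic to leading order.  Four derivatives make
  the third one continuous, which turns the Lagrange form of the remainder into the Peano form.
\<close>
lemma cubic_Taylor_bound:
  fixes f :: "real \<Rightarrow> real"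
  assumes S: "open S" "a \<in> S" and f: "times_differentiable_on 4 S f"
    and d: "deriv f a = 0" "(deriv ^^ 2) f a = 0"
    and e: "\<epsilon> > 0"
  shows "\<exists>d>0. \<forall>h. \<bar>h\<bar> < d \<longrightarrow>
    \<bar>f (a + h) - f a - (deriv ^^ 3) f a / 6 * h ^ 3\<bar> \<le> \<epsilon> * \<bar>h\<bar> ^ 3"
proof -
  define D where "D m = (deriv ^^ m) f" for m :: nat
  have D: "(D m has_real_derivative D (Suc m) x) (at x)" if "m < 4" "x \<in> S" for m x
  proof -
    have "4 = Suc (3 - m) + m" using that by simp
    then have "times_differentiable_on (Suc (3 - m)) S ((deriv ^^ m) f)"
      using times_differentiable_on_deriv[OF S(1)] f by metis
    from times_differentiable_on_DERIV_deriv[OF this that(2)] show ?thesis by (simp add: D_def)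
  qed
  have "isCont (D 3) a" using D[of 3 a] S by (auto intro: DERIV_isCont)
  then obtain d1 where d1: "d1 > 0" "\<And>x. \<bar>x - a\<bar> < d1 \<Longrightarrow> \<bar>D 3 x - D 3 a\<bar> < 6 * \<epsilon>"
    using e unfolding continuous_at_real_range real_norm_def by (metis zero_less_mult_iff zero_less_numeral)
  obtain d2 where d2: "d2 > 0" "cball a d2 \<subseteq> S" using S open_contains_cball by blast
  have "\<bar>f (a + h) - f a - D 3 a / 6 * h ^ 3\<bar> \<le> \<epsilon> * \<bar>h\<bar> ^ 3" if h: "\<bar>h\<bar> < min d1 d2" for h
  proof (cases "h = 0")
    case False
    have in_S: "t \<in> S" if "a - d2 \<le> t" "t \<le> a + d2" for t
      using d2(2) that by (auto simp: cball_def dist_real_def abs_le_iff subset_iff)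
    have DD: "\<forall>m t. m < 3 \<and> a - d2 \<le> t \<and> t \<le> a + d2 \<longrightarrow> (D m has_real_derivative D (Suc m) t) (at t)"
      using D in_S by simp
    have ex_t: "\<exists>t. (if a + h < a then a + h < t \<and> t < a else a < t \<and> t < a + h) \<and>
      f (a + h) = (\<Sum>m<3. (D m a / fact m) * (a + h - a)^m) + (D 3 t / fact 3) * (a + h - a)^3"
      by (rule Taylor[OF _ _ DD]) (use h d2(1) False in \<open>auto simp: D_def\<close>)
    obtain t where t: "if a + h < a then a + h < t \<and> t < a else a < t \<and> t < a + h"
      "f (a + h) = (\<Sum>m<3. (D m a / fact m) * (a + h - a)^m) + (D 3 t / fact 3) * (a + h - a)^3"
      using ex_t by blast
    have "f (a + h) - f a = D 3 t / 6 * h ^ 3"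
      using t(2) d by (simp add: eval_nat_numeral D_def)
    then have "f (a + h) - f a - D 3 a / 6 * h ^ 3 = (D 3 t - D 3 a) / 6 * h ^ 3"
      by (simp add: algebra_simps diff_divide_distrib)
    moreover have "\<bar>D 3 t - D 3 a\<bar> < 6 * \<epsilon>" using t(1) h by (intro d1(2)) (auto split: if_splits)
    then have "\<bar>(D 3 t - D 3 a) / 6\<bar> * \<bar>h\<bar> ^ 3 \<le> \<epsilon> * \<bar>h\<bar> ^ 3"
      by (intro mult_right_mono) auto
    ultimately show ?thesis
      by (simp only: abs_mult power_abs)
  qed simp
  then show ?thesis unfolding D_def using d1(1) d2(1) by (intro exI[of _ "min d1 d2"]) auto
qed


section \<open>The softplus, logistic and Bose functions\<close>

definition softplus :: "real \<Rightarrow> real" where "softplus x = ln (1 + exp x)"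
definition logistic :: "real \<Rightarrow> real" where "logistic x = exp x / (1 + exp x)"
text \<open>
  The Jacobian factor of the substitution \<open>v\<^sup>2 = softplus a - softplus x\<close>, as a function of
  \<open>z = - softplus x = v\<^sup>2 - softplus a\<close>: there it equals \<open>1 / logistic x\<close> (\<open>bose_softplus\<close>).
  As a function of \<open>- z\<close> it is one plus the Bose-Einstein distribution, smooth for \<open>z < 0\<close> with a
  pole at \<open>0\<close>.
\<close>
definition bose :: "real \<Rightarrow> real" where "bose z = 1 / (1 - exp z)"

lemma one_plus_exp_pos: "0 < 1 + exp (x::real)" by (simp add: add_pos_pos)

lemma softplus_pos: "0 < softplus x" by (simp add: softplus_def ln_gt_zero)

lemma softplus_less_iff [simp]: "softplus x < softplus y \<longleftrightarrow> x < y"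
  using one_plus_exp_pos by (simp add: softplus_def)

lemma softplus_le_iff [simp]: "softplus x \<le> softplus y \<longleftrightarrow> x \<le> y"
  using one_plus_exp_pos by (simp add: softplus_def)

lemma ln_ratio_softplus: "ln ((1 + exp a) / (1 + exp x)) = softplus a - softplus x"
  using one_plus_exp_pos[of a] one_plus_exp_pos[of x] by (simp add: softplus_def ln_div)

lemma logistic_pos: "0 < logistic x" using one_plus_exp_pos[of x] by (simp add: logistic_def)

lemma DERIV_softplus: "(softplus has_real_derivative logistic x) (at x)"
  unfolding softplus_def[abs_def] logistic_def using one_plus_exp_pos[of x]
  by (auto intro!: derivative_eq_intros)

lemma DERIV_logistic: "(logistic has_real_derivative 1 * logistic x + (-1) * (logistic x * logistic x)) (at x)"
proof -
  have "((\<lambda>x. exp x / (1 + exp x)) has_real_derivative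
      (exp x * (1 + exp x) - exp x * exp x) / ((1 + exp x) * (1 + exp x))) (at x)"
    using one_plus_exp_pos[of x] by (auto intro!: derivative_eq_intros)
  moreover have "(exp x * (1 + exp x) - exp x * exp x) / ((1 + exp x) * (1 + exp x)) =
      1 * logistic x + (-1) * (logistic x * logistic x)"
    using one_plus_exp_pos[of x] by (simp add: logistic_def diff_divide_distrib)
  ultimately show ?thesis by (simp only: logistic_def[abs_def])
qed

lemma DERIV_bose: "z < 0 \<Longrightarrow> (bose has_real_derivative (-1) * bose z + 1 * (bose z * bose z)) (at z)"
  unfolding bose_def[abs_def]
  by (auto intro!: derivative_eq_intros simp: divide_simps)

lemma bose_softplus: "bose (- softplus x) = 1 / logistic x"
  using one_plus_exp_pos[of x] by (simp add: bose_def softplus_def logistic_def exp_minus field_simps)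

lemma times_differentiable_on_softplus: "times_differentiable_on n S softplus"
proof (cases n)
  case (Suc k)
  have "times_differentiable_on k S logistic"
    using DERIV_logistic by (rule times_differentiable_on_logistic_ode)
  with Suc DERIV_softplus show ?thesis by auto
qed simp

lemma times_differentiable_on_bose: "times_differentiable_on n {..<0} bose"
  by (rule times_differentiable_on_logistic_ode[where c = "-1" and d = 1]) (use DERIV_bose in auto)

lemma isCont_softplus [continuous_intros]: "isCont f x \<Longrightarrow> isCont (\<lambda>x. softplus (f x)) x"
  using DERIV_softplus DERIV_isCont isCont_o2 by blast

lemma continuous_on_softplus [continuous_intros]:
  "continuous_on S f \<Longrightarrow> continuous_on S (\<lambda>x. softplus (f x))"
  by (rule continuous_on_compose2[of UNIV softplus])
     (auto intro!: continuous_at_imp_continuous_on DERIV_isCont DERIV_softplus)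

lemma continuous_on_bose [continuous_intros]:
  "continuous_on S f \<Longrightarrow> (\<And>x. x \<in> S \<Longrightarrow> f x < 0) \<Longrightarrow> continuous_on S (\<lambda>x. bose (f x))"
  unfolding bose_def by (intro continuous_intros) force+

section \<open>Removing the singularity of the integrals\<close>

text \<open>
  The pole of \<open>bose\<close> is never met: \<open>(A - B) * y\<^sup>2 - A\<close> runs from \<open>- A\<close> to \<open>- B\<close>.
\<close>
lemma scaled_argument_neg:
  fixes A B y :: real
  assumes "0 < B" "B < A" "y \<in> {0..1}"
  shows "(A - B) * y\<^sup>2 - A < 0"
proof -
  have "(A - B) * y\<^sup>2 \<le> (A - B) * 1"
    using assms by (intro mult_left_mono) (auto simp: power_le_one)
  also have "\<dots> < A" using assms by simp
  finally show ?thesis by simp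
qed

lemma DERIV_scaled_integral:
  fixes w g g' :: "real \<Rightarrow> real"
  assumes w: "continuous_on {0..1} w"
    and g: "\<And>z. z < 0 \<Longrightarrow> (g has_real_derivative g' z) (at z)"
    and g': "continuous_on {..<0} g'"
    and A: "0 < B" "B < A"
  shows "((\<lambda>A. integral {0..1} (\<lambda>y. w y * g ((A - B) * y\<^sup>2 - A))) has_real_derivative
           integral {0..1} (\<lambda>y. w y * (y\<^sup>2 - 1) * g' ((A - B) * y\<^sup>2 - A))) (at A)"
proof -
  have cg: "continuous_on {..<0} g"
    using g by (intro DERIV_continuous_on[of _ g g']) (auto intro: has_field_derivative_at_within)
  have d: "((\<lambda>A. w y * g ((A - B) * y\<^sup>2 - A)) has_real_derivative
      w y * (y\<^sup>2 - 1) * g' ((A - B) * y\<^sup>2 - A)) (at A within {B<..})"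
    if A: "A \<in> {B<..}" and y: "y \<in> cbox 0 1" for A y
  proof -
    have "((\<lambda>A. (A - B) * y\<^sup>2 - A) has_real_derivative y\<^sup>2 - 1) (at A within {B<..})"
      by (auto intro!: derivative_eq_intros)
    moreover have "(A - B) * y\<^sup>2 - A < 0" using scaled_argument_neg[of B A y] assms(4) A y by auto
    ultimately have "((\<lambda>A. g ((A - B) * y\<^sup>2 - A)) has_real_derivative
        g' ((A - B) * y\<^sup>2 - A) * (y\<^sup>2 - 1)) (at A within {B<..})"
      by (intro DERIV_chain2[OF g])
    from DERIV_cmult[OF this, of "w y"] show ?thesis by (simp add: mult.assoc mult.commute)
  qed
  have c: "continuous_on ({B<..} \<times> cbox 0 1) (\<lambda>(A, y). w y * (y\<^sup>2 - 1) * g' ((A - B) * y\<^sup>2 - A))"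
    unfolding split_beta
    by (intro continuous_intros continuous_on_compose2[OF w] continuous_on_compose2[OF g'])
       (use scaled_argument_neg[of B] assms(4) in auto)
  have i: "(\<lambda>y. w y * g ((A - B) * y\<^sup>2 - A)) integrable_on cbox 0 1" if "A \<in> {B<..}" for A
    by (intro integrable_continuous continuous_intros continuous_on_compose2[OF w]
        continuous_on_compose2[OF cg])
       (use scaled_argument_neg[of B A] assms(4) that in auto)
  have "((\<lambda>A. integral (cbox 0 1) (\<lambda>y. w y * g ((A - B) * y\<^sup>2 - A))) has_real_derivative
         integral (cbox 0 1) (\<lambda>y. w y * (y\<^sup>2 - 1) * g' ((A - B) * y\<^sup>2 - A))) (at A within {B<..})"
    using A by (intro leibniz_rule_field_derivative d i c) auto
  then show ?thesis using A by (simp add: at_within_open[of A "{B<..}"])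
qed

text \<open>
  Differentiating under the integral sign multiplies the weight by \<open>y\<^sup>2 - 1\<close> and replaces \<open>g\<close> by its
  derivative; since the resulting integral has the same form, the step can be iterated.  One order is
  lost because the derivative of \<open>g\<close> has to be continuous.
\<close>
lemma times_differentiable_on_scaled_integral:
  assumes B: "0 < B"
  shows "continuous_on {0..1} w \<Longrightarrow> times_differentiable_on (Suc n) {..<0} g \<Longrightarrow>
    times_differentiable_on n {B<..} (\<lambda>A. integral {0..1} (\<lambda>y. w y * g ((A - B) * y\<^sup>2 - A)))"
proof (induction n arbitrary: w g)
  case (Suc n)
  then obtain g' where g': "\<forall>z\<in>{..<0}. (g has_real_derivative g' z) (at z)"
    "times_differentiable_on (Suc n) {..<0} g'" by auto
  have "continuous_on {..<0} g'"
    using times_differentiable_on_DERIV_deriv[OF g'(2)]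
    by (intro DERIV_continuous_on[of _ g' "deriv g'"]) (auto intro: has_field_derivative_at_within)
  then have "((\<lambda>A. integral {0..1} (\<lambda>y. w y * g ((A - B) * y\<^sup>2 - A))) has_real_derivative
           integral {0..1} (\<lambda>y. w y * (y\<^sup>2 - 1) * g' ((A - B) * y\<^sup>2 - A))) (at A)"
    if "A \<in> {B<..}" for A
    using that B g'(1) Suc.prems(1) by (intro DERIV_scaled_integral) auto
  moreover have "times_differentiable_on n {B<..}
      (\<lambda>A. integral {0..1} (\<lambda>y. w y * (y\<^sup>2 - 1) * g' ((A - B) * y\<^sup>2 - A)))"
    using g'(2) Suc.prems(1) by (intro Suc.IH continuous_intros)
  ultimately show ?case by (intro times_differentiable_on_SucI)
qed simp

lemma integral_scale:
  fixes f :: "real \<Rightarrow> real"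
  assumes "0 < V"
  shows "integral {0..V} f = V * integral {0..1} (\<lambda>y. f (V * y))"
proof -
  have "(\<lambda>x. x / V) ` {0..V} = {0..1}"
    using image_divide_atLeastAtMost[of V 0 V] assms by simp
  then show ?thesis using integral_stretch_real[of V 0 V f] assms by simp
qed

lemma bose_integrand_continuous:
  assumes "continuous_on UNIV q" "0 \<le> c" "c < \<bar>b\<bar>" "b < 0"
  shows "continuous_on {0..sqrt c} (\<lambda>v. 2 * q v * bose (v\<^sup>2 + b))"
proof -
  have "v\<^sup>2 + b < 0" if "v \<in> {0..sqrt c}" for v
  proof -
    have "v\<^sup>2 \<le> (sqrt c)\<^sup>2" using that by (intro power_mono) auto
    then show ?thesis using assms by simp
  qed
  then show ?thesis
    by (intro continuous_intros continuous_on_subset[OF assms(1)]) auto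
qed

text \<open>
  The substitution \<open>v\<^sup>2 = softplus a - softplus x\<close> in infinitesimal form, away from the singular point
  \<open>x = a\<close>.  Since the lower limit \<open>x\<close> is the variable, the case \<open>q = 1\<close> also gives the derivative of
  \<open>F\<close> in \<open>ln \<rho>\<close>.
\<close>
lemma DERIV_bose_substitution:
  assumes q: "continuous_on UNIV q" and x: "x < a"
  shows "((\<lambda>x. integral {0..sqrt (softplus a - softplus x)} (\<lambda>v. 2 * q v * bose (v\<^sup>2 + - softplus a)))
    has_real_derivative - (q (sqrt (softplus a - softplus x)) / sqrt (softplus a - softplus x))) (at x)"
proof -
  let ?u = "\<lambda>x. softplus a - softplus x"
  let ?f = "\<lambda>v. 2 * q v * bose (v\<^sup>2 + - softplus a)"
  have u: "0 < ?u x" "?u x < ?u (x - 1)" using x by auto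
  have "continuous_on {0..sqrt (?u (x - 1))} ?f"
    by (rule bose_integrand_continuous[OF q]) (use softplus_pos[of "x - 1"] softplus_pos[of a] x in auto)
  then have "((\<lambda>V. integral {0..V} ?f) has_real_derivative ?f (sqrt (?u x))) (at (sqrt (?u x)) within {0..sqrt (?u (x - 1))})"
    by (rule integral_has_real_derivative) (use u in auto)
  moreover have "at (sqrt (?u x)) within {0..sqrt (?u (x - 1))} = at (sqrt (?u x))"
    by (rule at_within_Icc_at) (use u in auto)
  ultimately have 1: "((\<lambda>V. integral {0..V} ?f) has_real_derivative ?f (sqrt (?u x))) (at (sqrt (?u x)))"
    by simp
  have 2: "((\<lambda>x. sqrt (?u x)) has_real_derivative (0 - logistic x) * (inverse (sqrt (?u x)) / 2)) (at x)"
    using DERIV_chain2[where f = sqrt and g = ?u, OF DERIV_real_sqrt[OF u(1)] DERIV_diff[OF DERIV_const DERIV_softplus]]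
    by (simp add: mult.commute)
  have "?f (sqrt (?u x)) * ((0 - logistic x) * (inverse (sqrt (?u x)) / 2)) = - (q (sqrt (?u x)) / sqrt (?u x))"
    using u(1) logistic_pos[of x] by (simp add: bose_softplus field_simps)
  with DERIV_chain2[OF 1 2] show ?thesis by simp
qed

text \<open>
  The antiderivative remains continuous at the singular end point \<open>a\<close>, which is enough for the
  fundamental theorem of calculus.  At \<open>x = a\<close> the integrand on the left is \<open>q 0 / 0 = 0\<close>.
  The constant \<open>q = 1\<close> gives \<open>F\<close>, and \<open>q v = v\<^sup>2\<close> gives the integral in the objective.
\<close>
lemma bose_substitution:
  assumes q: "continuous_on UNIV q" and r: "r < a"
  shows "((\<lambda>x. q (sqrt (softplus a - softplus x)) / sqrt (softplus a - softplus x)) has_integral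
     integral {0..sqrt (softplus a - softplus r)} (\<lambda>v. 2 * q v * bose (v\<^sup>2 + - softplus a))) {r..a}"
proof -
  let ?u = "\<lambda>x. softplus a - softplus x"
  let ?f = "\<lambda>v. 2 * q v * bose (v\<^sup>2 + - softplus a)"
  let ?N = "\<lambda>x. - integral {0..sqrt (?u x)} ?f"
  have "?f integrable_on {0..sqrt (?u r)}"
    by (intro integrable_continuous_real bose_integrand_continuous[OF q])
       (use softplus_pos[of r] softplus_pos[of a] r in auto)
  then have "continuous_on {0..sqrt (?u r)} (\<lambda>V. integral {0..V} ?f)"
    by (rule indefinite_integral_continuous_1)
  moreover have "continuous_on {r..a} (\<lambda>x. sqrt (?u x))"
    by (intro continuous_intros)
  moreover have "(\<lambda>x. sqrt (?u x)) ` {r..a} \<subseteq> {0..sqrt (?u r)}" by auto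
  ultimately have "continuous_on {r..a} (\<lambda>x. integral {0..sqrt (?u x)} ?f)"
    by (rule continuous_on_compose2)
  then have "continuous_on {r..a} ?N"
    by (rule continuous_on_minus)
  moreover have "(?N has_vector_derivative q (sqrt (?u x)) / sqrt (?u x)) (at x)" if "x \<in> {r<..<a}" for x
    using DERIV_minus[OF DERIV_bose_substitution[OF q, of x a]] that
    by (simp add: has_real_derivative_iff_has_vector_derivative)
  ultimately have "((\<lambda>x. q (sqrt (?u x)) / sqrt (?u x)) has_integral ?N a - ?N r) {r..a}"
    using r by (intro fundamental_theorem_of_calculus_interior) auto
  then show ?thesis by simp
qed

lemma F_bose:
  assumes "r < a"
  shows "F a (exp r) = integral {0..sqrt (softplus a - softplus r)} (\<lambda>v. 2 * 1 * bose (v\<^sup>2 + - softplus a))"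
  using integral_unique[OF bose_substitution[of "\<lambda>_. 1", OF continuous_on_const assms]]
  by (simp add: F_def ln_ratio_softplus)

lemma F_scaled:
  assumes "r < a"
  shows "F a (exp r) = 2 * sqrt (softplus a - softplus r) *
    integral {0..1} (\<lambda>y. 1 * bose ((softplus a - softplus r) * y\<^sup>2 - softplus a))"
proof -
  have "sqrt (softplus a - softplus r) > 0" using assms by simp
  from integral_scale[OF this] show ?thesis using assms
    by (simp add: F_bose power_mult_distrib)
qed

lemma integral_sqrt_scaled:
  assumes "r < a"
  shows "integral {r..a} (\<lambda>x. sqrt (ln ((1 + exp a) / (1 + exp x)))) =
    2 * ((softplus a - softplus r) * sqrt (softplus a - softplus r)) *
    integral {0..1} (\<lambda>y. y\<^sup>2 * bose ((softplus a - softplus r) * y\<^sup>2 - softplus a))"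
proof -
  let ?D = "softplus a - softplus r"
  have D: "sqrt ?D > 0" using assms by simp
  have "integral {r..a} (\<lambda>x. sqrt (ln ((1 + exp a) / (1 + exp x)))) =
      integral {r..a} (\<lambda>x. (sqrt (softplus a - softplus x))\<^sup>2 / sqrt (softplus a - softplus x))"
    by (rule integral_cong) (simp add: ln_ratio_softplus real_div_sqrt)
  also have "\<dots> = integral {0..sqrt ?D} (\<lambda>v. 2 * v\<^sup>2 * bose (v\<^sup>2 + - softplus a))"
    by (rule integral_unique[OF bose_substitution]) (use assms in \<open>auto intro!: continuous_intros\<close>)
  also have "\<dots> = 2 * (?D * sqrt ?D) * integral {0..1} (\<lambda>y. y\<^sup>2 * bose (?D * y\<^sup>2 - softplus a))"
    unfolding integral_scale[OF D]
    using assms by (simp add: power_mult_distrib mult.assoc mult.left_commute)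
  finally show ?thesis .
qed

lemma times_differentiable_on_F:
  "times_differentiable_on n {r<..} (\<lambda>a. F a (exp r))"
proof -
  let ?B = "softplus r"
  let ?H = "\<lambda>A. integral {0..1} (\<lambda>y. 1 * bose ((A - ?B) * y\<^sup>2 - A))"
  have "times_differentiable_on n {r<..} (\<lambda>a. softplus a + - ?B)"
    by (intro times_differentiable_on_add times_differentiable_on_softplus times_differentiable_on_const)
  then have s: "times_differentiable_on n {r<..} (\<lambda>a. (softplus a + - ?B) powr (1/2))"
    by (intro times_differentiable_on_compose[OF _ times_differentiable_on_powr[of n "1/2"]]) auto
  have "times_differentiable_on n {?B<..} ?H"
    by (intro times_differentiable_on_scaled_integral softplus_pos times_differentiable_on_bose
        continuous_intros)
  then have h: "times_differentiable_on n {r<..} (\<lambda>a. ?H (softplus a))"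
    by (intro times_differentiable_on_compose[of _ softplus "{?B<..}" n ?H] times_differentiable_on_softplus) auto
  have "times_differentiable_on n {r<..} (\<lambda>a. 2 * (softplus a + - ?B) powr (1/2) * ?H (softplus a))"
    by (intro times_differentiable_on_mult times_differentiable_on_const s h)
  then show ?thesis
    by (rule times_differentiable_on_cong[rotated 2]) (auto simp: F_scaled powr_half_sqrt)
qed

lemma DERIV_F_ln_rho:
  assumes "r < a"
  shows "((\<lambda>r. F a (exp r)) has_real_derivative - (1 / sqrt (softplus a - softplus r))) (at r)"
proof (rule has_field_derivative_transform_within_open)
  show "((\<lambda>x. integral {0..sqrt (softplus a - softplus x)} (\<lambda>v. 2 * 1 * bose (v\<^sup>2 + - softplus a)))
    has_real_derivative - (1 / sqrt (softplus a - softplus r))) (at r)"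
    using DERIV_bose_substitution[of "\<lambda>_. 1", OF continuous_on_const assms] .
  show "open {..<a}" "r \<in> {..<a}" using assms by auto
qed (simp add: F_bose)

text \<open>
  The derivative of the integral of \<open>sqrt (softplus a - softplus x)\<close> should be
  \<open>logistic a * F a \<rho> / 2\<close>, by formally differentiating under the integral sign.  In the rescaled form
  this becomes an identity between integrals over the unit interval, which is an integration by parts
  against \<open>y ^ 3 - y\<close>, a function without boundary terms.
\<close>
lemma DERIV_objective:
  assumes "r < a"
  shows "(objective (exp r) \<beta> has_real_derivative logistic a * (1 - F a (exp r) / (2 * sqrt \<beta>))) (at a)"
proof -
  define B where "B = softplus r"
  define A where "A = softplus a"
  define bose' where "bose' z = (-1) * bose z + 1 * (bose z * bose z)" for z
  define H where "H A = integral {0..1} (\<lambda>y. y\<^sup>2 * bose ((A - B) * y\<^sup>2 - A))" for A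
  define H' where "H' = integral {0..1} (\<lambda>y. y\<^sup>2 * (y\<^sup>2 - 1) * bose' ((A - B) * y\<^sup>2 - A))"
  define H0 where "H0 = integral {0..1} (\<lambda>y. 1 * bose ((A - B) * y\<^sup>2 - A))"
  have AB: "0 < B" "B < A" using assms by (auto simp: A_def B_def softplus_pos)
  have neg: "(A - B) * y\<^sup>2 - A < 0" if "y \<in> {0..1}" for y
    using scaled_argument_neg AB that by blast
  have dbose: "(bose has_real_derivative bose' z) (at z)" if "z < 0" for z
    using DERIV_bose[OF that] by (simp only: bose'_def)
  have cbose': "continuous_on {..<0} bose'"
    unfolding bose'_def by (intro continuous_intros) auto
  have dH: "(H has_real_derivative H') (at A)"
    unfolding H_def H'_def
    by (rule DERIV_scaled_integral) (use AB dbose cbose' in \<open>auto intro!: continuous_intros\<close>)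
  \<comment> \<open>Integrate the derivative of \<open>(y ^ 3 - y) * bose ((A - B) * y\<^sup>2 - A)\<close> over the unit interval.\<close>
  have parts: "3 * H A + 2 * (A - B) * H' = H0"
  proof -
    let ?z = "\<lambda>y. (A - B) * y\<^sup>2 - A"
    have int: "(\<lambda>y. w y * g (?z y)) integrable_on {0..1}"
      if "continuous_on {..<0} g" "continuous_on {0..1} w" for w g :: "real \<Rightarrow> real"
      by (intro integrable_continuous_real continuous_intros that continuous_on_compose2[OF that(1)])
         (use neg in auto)
    have cb: "continuous_on {..<0} bose" by (intro continuous_intros) auto
    have "((\<lambda>y. (y ^ 3 - y) * bose (?z y)) has_vector_derivative
        3 * (y\<^sup>2 * bose (?z y)) - 1 * bose (?z y) + 2 * (A - B) * (y\<^sup>2 * (y\<^sup>2 - 1) * bose' (?z y))) (at y within {0..1})"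
      if y: "y \<in> {0..1}" for y
    proof -
      have "((\<lambda>y. (y ^ 3 - y) * bose (?z y)) has_real_derivative
         (3 * y\<^sup>2 - 1) * bose (?z y) + bose' (?z y) * (2 * (A - B) * y) * (y ^ 3 - y)) (at y within {0..1})"
      proof (rule DERIV_mult)
        show "((\<lambda>y. y ^ 3 - y) has_real_derivative 3 * y\<^sup>2 - 1) (at y within {0..1})"
          by (auto intro!: derivative_eq_intros)
        have "(?z has_real_derivative 2 * (A - B) * y) (at y within {0..1})"
          by (auto intro!: derivative_eq_intros)
        then show "((\<lambda>y. bose (?z y)) has_real_derivative bose' (?z y) * (2 * (A - B) * y)) (at y within {0..1})"
          by (rule DERIV_chain2[where f = bose and g = ?z, OF dbose[OF neg[OF y]]])
      qed
      moreover have "(3 * y\<^sup>2 - 1) * bose (?z y) + bose' (?z y) * (2 * (A - B) * y) * (y ^ 3 - y) =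
        3 * (y\<^sup>2 * bose (?z y)) - 1 * bose (?z y) + 2 * (A - B) * (y\<^sup>2 * (y\<^sup>2 - 1) * bose' (?z y))"
        by (simp add: algebra_simps power2_eq_square power3_eq_cube)
      ultimately show ?thesis by (simp only: has_real_derivative_iff_has_vector_derivative)
    qed
    then have 1: "((\<lambda>y. 3 * (y\<^sup>2 * bose (?z y)) - 1 * bose (?z y) + 2 * (A - B) * (y\<^sup>2 * (y\<^sup>2 - 1) * bose' (?z y)))
        has_integral (1 ^ 3 - 1) * bose (?z 1) - (0 ^ 3 - 0) * bose (?z 0)) {0..1}"
      by (intro fundamental_theorem_of_calculus) auto
    have 2: "((\<lambda>y. 3 * (y\<^sup>2 * bose (?z y)) - 1 * bose (?z y) + 2 * (A - B) * (y\<^sup>2 * (y\<^sup>2 - 1) * bose' (?z y)))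
        has_integral 3 * H A - H0 + 2 * (A - B) * H') {0..1}"
      unfolding H_def H0_def H'_def
      by (intro has_integral_add has_integral_diff has_integral_mult_right integrable_integral int cb cbose'
          continuous_intros)
    from has_integral_unique[OF 1 2] show ?thesis by simp
  qed
  have "((\<lambda>a. softplus a - 1 / sqrt \<beta> * (2 * ((softplus a - B) * sqrt (softplus a - B)) * H (softplus a)))
     has_real_derivative logistic a * (1 - F a (exp r) / (2 * sqrt \<beta>))) (at a)"
  proof -
    have D: "0 < A - B" using AB by simp
    have "((\<lambda>A. 2 * ((A - B) * sqrt (A - B)) * H A) has_real_derivative
       2 * (1 * sqrt (A - B) + inverse (sqrt (A - B)) / 2 * (A - B)) * H A + H' * (2 * ((A - B) * sqrt (A - B)))) (at A)"
    proof (intro DERIV_mult dH DERIV_cmult)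
      show "((\<lambda>A. A - B) has_real_derivative 1) (at A)" by (auto intro!: derivative_eq_intros)
      then show "((\<lambda>A. sqrt (A - B)) has_real_derivative inverse (sqrt (A - B)) / 2) (at A)"
        using DERIV_chain2[where f = sqrt and g = "\<lambda>A. A - B", OF DERIV_real_sqrt[OF D]] by fastforce
    qed
    moreover have "inverse (sqrt (A - B)) / 2 * (A - B) = sqrt (A - B) / 2"
      using D by (simp add: field_simps real_div_sqrt)
    moreover have "2 * (1 * sqrt (A - B) + sqrt (A - B) / 2) * H A + H' * (2 * ((A - B) * sqrt (A - B)))
       = sqrt (A - B) * (3 * H A + 2 * (A - B) * H')"
      by (simp add: algebra_simps)
    ultimately have "((\<lambda>A. 2 * ((A - B) * sqrt (A - B)) * H A) has_real_derivative sqrt (A - B) * H0) (at A)"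
      by (simp only: parts)
    then have "((\<lambda>a. 2 * ((softplus a - B) * sqrt (softplus a - B)) * H (softplus a))
        has_real_derivative sqrt (A - B) * H0 * logistic a) (at a)"
      unfolding A_def by (rule DERIV_chain2[OF _ DERIV_softplus])
    from DERIV_diff[OF DERIV_softplus DERIV_cmult[OF this, of "1 / sqrt \<beta>"]]
    show ?thesis
      by (simp add: F_scaled[OF assms, folded A_def B_def] H0_def algebra_simps)
  qed
  then show ?thesis
  proof (rule has_field_derivative_transform_within_open)
    show "open {r<..}" "a \<in> {r<..}" using assms by auto
  qed (simp add: objective_def integral_sqrt_scaled H_def B_def, simp add: softplus_def)
qed

section \<open>Expansion of F at the critical point\<close>

text \<open>
  The expansion splits into the part at \<open>r\<^sub>c\<close>, where Taylor's theorem leaves only the cubic term, and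
  the change of \<open>F (a\<^sub>c + h) - F a\<^sub>c\<close> between \<open>r\<^sub>c\<close> and \<open>r\<close>.  The latter is a mixed second difference,
  controlled by applying the mean value inequality in \<open>r\<close> and then in \<open>a\<close>.  The mixed derivative of \<open>F\<close>
  in \<open>r = ln \<rho>\<close> and \<open>a\<close> is the explicit continuous function \<open>Q\<close> with value \<open>q\<close> at the critical point.
\<close>
lemma F_expansion:
  assumes r: "r\<^sub>c < a\<^sub>c"
    and d: "deriv (\<lambda>a. F a (exp r\<^sub>c)) a\<^sub>c = 0" "(deriv ^^ 2) (\<lambda>a. F a (exp r\<^sub>c)) a\<^sub>c = 0"
    and e: "0 < \<epsilon>"
  defines "q \<equiv> logistic a\<^sub>c / 2 * (softplus a\<^sub>c - softplus r\<^sub>c) powr (-3/2)"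
    and "\<tau> \<equiv> (deriv ^^ 3) (\<lambda>a. F a (exp r\<^sub>c)) a\<^sub>c / 6"
  shows "\<exists>d>0. \<forall>h r. \<bar>h\<bar> < d \<longrightarrow> \<bar>r - r\<^sub>c\<bar> < d \<longrightarrow>
    \<bar>F (a\<^sub>c + h) (exp r) - F a\<^sub>c (exp r) - q * (r - r\<^sub>c) * h - \<tau> * h ^ 3\<bar>
      \<le> \<epsilon> * (\<bar>r - r\<^sub>c\<bar> * \<bar>h\<bar> + \<bar>h\<bar> ^ 3)"
proof -
  define k where "k a r = 1 / sqrt (softplus a - softplus r)" for a r
  define Q where "Q p = logistic (fst p) / 2 * (softplus (fst p) - softplus (snd p)) powr (-3/2)" for p :: "real \<times> real"
  have "isCont Q (a\<^sub>c, r\<^sub>c)"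
    unfolding Q_def using r
    by (intro continuous_intros continuous_at_compose[of _ fst logistic, unfolded o_def]
         DERIV_isCont[OF DERIV_logistic]) (use softplus_less_iff[of r\<^sub>c a\<^sub>c] in \<open>auto simp del: softplus_less_iff\<close>)
  then obtain d1 where d1: "d1 > 0" "\<And>p. dist p (a\<^sub>c, r\<^sub>c) < d1 \<Longrightarrow> dist (Q p) q < \<epsilon>"
    using e unfolding continuous_at_eps_delta by (auto simp: Q_def q_def)
  obtain d2 where d2: "d2 > 0" "\<And>h. \<bar>h\<bar> < d2 \<Longrightarrow>
    \<bar>F (a\<^sub>c + h) (exp r\<^sub>c) - F a\<^sub>c (exp r\<^sub>c) - \<tau> * h ^ 3\<bar> \<le> \<epsilon> * \<bar>h\<bar> ^ 3"
    using cubic_Taylor_bound[of "{r\<^sub>c<..}" a\<^sub>c, OF _ _ times_differentiable_on_F d e] r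
    unfolding \<tau>_def by auto
  define d where "d = min (d1 / 2) (min d2 ((a\<^sub>c - r\<^sub>c) / 2))"
  have d: "0 < d" "d \<le> d1 / 2" "d \<le> d2" "d \<le> (a\<^sub>c - r\<^sub>c) / 2"
    using d1(1) d2(1) r unfolding d_def by (simp, linarith+)
  have Q: "\<bar>Q (a, r) - q\<bar> \<le> \<epsilon>" "r < a" if "a \<in> ball a\<^sub>c d" "r \<in> ball r\<^sub>c d" for a r
  proof -
    have *: "\<bar>a - a\<^sub>c\<bar> < d" "\<bar>r - r\<^sub>c\<bar> < d" using that by (auto simp: dist_real_def abs_minus_commute)
    have "dist (a, r) (a\<^sub>c, r\<^sub>c) \<le> \<bar>a - a\<^sub>c\<bar> + \<bar>r - r\<^sub>c\<bar>"
      using sqrt_sum_squares_le_sum_abs[of "a - a\<^sub>c" "r - r\<^sub>c"] by (simp add: dist_Pair_Pair dist_real_def)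
    also have "\<dots> < d1" using * d(2) by linarith
    finally show "\<bar>Q (a, r) - q\<bar> \<le> \<epsilon>" using d1(2) by (fastforce simp: dist_real_def)
    show "r < a" using * d(4) by (auto simp: abs_less_iff)
  qed
  \<comment> \<open>\<open>- k a r\<close> is the derivative of \<open>F a (exp r)\<close> in \<open>r\<close>, so \<open>Q\<close> is the mixed derivative of \<open>F\<close>.\<close>
  have dk: "((\<lambda>a. - k a r - q * a) has_real_derivative Q (a, r) - q) (at a)" if "r < a" for a r
  proof -
    let ?u = "softplus a - softplus r"
    have u: "0 < ?u" using that by simp
    have "((\<lambda>a. softplus a - softplus r) has_real_derivative logistic a) (at a)"
      using DERIV_diff[OF DERIV_softplus DERIV_const[of "softplus r"]] by simp
    from DERIV_fun_powr[OF this u, of "-1/2"]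
    have "((\<lambda>a. (softplus a - softplus r) powr (-1/2)) has_real_derivative - Q (a, r)) (at a)"
      by (simp add: Q_def mult.commute)
    moreover have "k b r = (softplus b - softplus r) powr (-1/2)" if "b \<in> {r<..}" for b
      using that powr_minus_divide[of "softplus b - softplus r" "1/2"] by (simp add: k_def powr_half_sqrt)
    ultimately have "((\<lambda>a. k a r) has_real_derivative - Q (a, r)) (at a)"
      using that by (intro has_field_derivative_transform_within_open[of _ _ a "{r<..}" "\<lambda>a. k a r"]) auto
    from DERIV_diff[OF DERIV_minus[OF this] DERIV_cmult[OF DERIV_ident, of q]] show ?thesis by simp
  qed
  have "\<bar>F (a\<^sub>c + h) (exp r) - F a\<^sub>c (exp r) - q * (r - r\<^sub>c) * h - \<tau> * h ^ 3\<bar>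
      \<le> \<epsilon> * (\<bar>r - r\<^sub>c\<bar> * \<bar>h\<bar> + \<bar>h\<bar> ^ 3)" if h: "\<bar>h\<bar> < d" and s: "\<bar>r - r\<^sub>c\<bar> < d" for h r
  proof -
    have b: "a\<^sub>c + h \<in> ball a\<^sub>c d" "a\<^sub>c \<in> ball a\<^sub>c d" "r \<in> ball r\<^sub>c d" "r\<^sub>c \<in> ball r\<^sub>c d"
      using h s d(1) by (auto simp: dist_real_def)
    \<comment> \<open>Subtracting the linear term \<open>q * h * r\<close> makes the derivative of \<open>G\<close> small instead of merely close to \<open>q * h\<close>.\<close>
    define G where "G r = F (a\<^sub>c + h) (exp r) - F a\<^sub>c (exp r) - q * h * r" for r
    define G' where "G' r = - k (a\<^sub>c + h) r - - k a\<^sub>c r - q * h" for r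
    have dG: "(G has_real_derivative G' r) (at r within ball r\<^sub>c d)" if "r \<in> ball r\<^sub>c d" for r
      unfolding G_def G'_def k_def
      by (rule has_field_derivative_at_within[OF DERIV_diff[OF
          DERIV_diff[OF DERIV_F_ln_rho[OF Q(2)[OF b(1) that]] DERIV_F_ln_rho[OF Q(2)[OF b(2) that]]]
          DERIV_cmult_Id[of "q * h"]]])
    have "norm (G' r) \<le> \<epsilon> * \<bar>h\<bar>" if "r \<in> ball r\<^sub>c d" for r
    proof -
      have "norm ((- k (a\<^sub>c + h) r - q * (a\<^sub>c + h)) - (- k a\<^sub>c r - q * a\<^sub>c)) \<le> \<epsilon> * norm (a\<^sub>c + h - a\<^sub>c)"
        by (rule field_differentiable_bound[OF convex_ball has_field_derivative_at_within[OF dk[OF Q(2)]]])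
           (use Q that b in auto)
      then show ?thesis by (simp add: G'_def algebra_simps)
    qed
    then have "norm (G r - G r\<^sub>c) \<le> \<epsilon> * \<bar>h\<bar> * norm (r - r\<^sub>c)"
      by (intro field_differentiable_bound[OF convex_ball dG]) (use b in auto)
    then have "\<bar>G r - G r\<^sub>c\<bar> \<le> \<epsilon> * (\<bar>r - r\<^sub>c\<bar> * \<bar>h\<bar>)" by (simp add: mult.commute mult.left_commute)
    moreover have "\<bar>F (a\<^sub>c + h) (exp r\<^sub>c) - F a\<^sub>c (exp r\<^sub>c) - \<tau> * h ^ 3\<bar> \<le> \<epsilon> * \<bar>h\<bar> ^ 3"
      using d2(2) h d(3) by simp
    moreover have "F (a\<^sub>c + h) (exp r) - F a\<^sub>c (exp r) - q * (r - r\<^sub>c) * h - \<tau> * h ^ 3 =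
      (G r - G r\<^sub>c) + (F (a\<^sub>c + h) (exp r\<^sub>c) - F a\<^sub>c (exp r\<^sub>c) - \<tau> * h ^ 3)"
      by (simp add: G_def algebra_simps)
    ultimately show ?thesis by (simp only: distrib_left)
  qed
  then show ?thesis using d(1) by blast
qed


section \<open>The equal-area rule for a nearly cubic function\<close>

text \<open>
  Let \<open>l = h\<^sub>2 - h\<^sub>1\<close> and let \<open>P\<close> be the cubic approximating \<open>f\<close>.  Subtracting \<open>P h\<^sub>1 \<approx> 0\<close> from
  \<open>P h\<^sub>2 \<approx> 0\<close> first shows that \<open>s\<close> is of order \<open>l\<^sup>2\<close>, so that all terms of \<open>P\<close> and \<open>f 0\<close> are of order
  \<open>l ^ 3\<close> and all errors of order \<open>\<epsilon> * l ^ 3\<close>.  The end point values and the area of \<open>P\<close> are then both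
  nearly zero, while the trapezoidal rule for \<open>P\<close> has the exact error
  \<open>\<tau> / 4 * (h\<^sub>1 + h\<^sub>2) * l ^ 3\<close>; so \<open>h\<^sub>1 + h\<^sub>2\<close> is of order \<open>\<epsilon> * l\<close>.  Inserting this in
  \<open>P h\<^sub>2 - P h\<^sub>1 \<approx> 0\<close> determines \<open>s\<close>.  The weight \<open>v\<close> may differ from \<open>1\<close> by \<open>\<epsilon>\<close> without harm
  because \<open>f\<close> itself is of order \<open>l ^ 3\<close>.
\<close>
lemma equal_area_cubic_bounds:
  fixes q \<tau> :: real
  assumes q: "0 < q" and \<tau>: "0 < \<tau>"
  obtains C where "0 < C"
    "\<And>f v :: real \<Rightarrow> real. \<And>h\<^sub>1 h\<^sub>2 s \<epsilon>. \<lbrakk>h\<^sub>1 < 0; 0 < h\<^sub>2; f h\<^sub>1 = 0; f h\<^sub>2 = 0; 0 < \<epsilon>; \<epsilon> \<le> 1; \<epsilon> \<le> q / 4;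
       continuous_on {h\<^sub>1..h\<^sub>2} f; continuous_on {h\<^sub>1..h\<^sub>2} v;
       integral {h\<^sub>1..h\<^sub>2} (\<lambda>h. v h * f h) = 0;
       \<And>h. h \<in> {h\<^sub>1..h\<^sub>2} \<Longrightarrow> \<bar>v h - 1\<bar> \<le> \<epsilon>;
       \<And>h. h \<in> {h\<^sub>1..h\<^sub>2} \<Longrightarrow> \<bar>f h - f 0 - q * s * h - \<tau> * h ^ 3\<bar> \<le> \<epsilon> * (\<bar>s\<bar> * \<bar>h\<bar> + \<bar>h\<bar> ^ 3)\<rbrakk>
     \<Longrightarrow> \<bar>f 0\<bar> \<le> C * (h\<^sub>2 - h\<^sub>1) ^ 3 \<and> \<bar>q * s + \<tau> / 4 * (h\<^sub>2 - h\<^sub>1)\<^sup>2\<bar> \<le> C * \<epsilon> * (h\<^sub>2 - h\<^sub>1)\<^sup>2"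
proof -
  define K where "K = 2 * \<tau> / q + 1"
  define M\<^sub>0 where "M\<^sub>0 = q * K + \<tau> + (K + 1)"
  define M where "M = M\<^sub>0 + q * K + \<tau> + (K + 1)"
  define C\<^sub>1 where "C\<^sub>1 = 4 / \<tau> * (2 * (K + 1) + M)"
  define C where "C = M\<^sub>0 + 2 * (K + 1) + 3 / 4 * \<tau> * C\<^sub>1"
  have pos: "0 < K" "0 < M\<^sub>0" "0 < M" "0 < C\<^sub>1"
    using q \<tau> by (auto simp: K_def M\<^sub>0_def M_def C\<^sub>1_def intro!: add_pos_pos mult_pos_pos divide_pos_pos)
  then have C: "0 < C" "M\<^sub>0 \<le> C" "2 * (K + 1) + 3 / 4 * \<tau> * C\<^sub>1 \<le> C"
    using \<tau> by (auto simp: C_def intro!: add_pos_pos)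
  show ?thesis
  proof (rule that[OF C(1)])
    fix f v :: "real \<Rightarrow> real" and h\<^sub>1 h\<^sub>2 s \<epsilon> :: real
    assume h: "h\<^sub>1 < 0" "0 < h\<^sub>2" and f0: "f h\<^sub>1 = 0" "f h\<^sub>2 = 0" and e: "0 < \<epsilon>" "\<epsilon> \<le> 1" "\<epsilon> \<le> q / 4"
      and cont: "continuous_on {h\<^sub>1..h\<^sub>2} f" "continuous_on {h\<^sub>1..h\<^sub>2} v"
      and area: "integral {h\<^sub>1..h\<^sub>2} (\<lambda>h. v h * f h) = 0"
      and v: "\<And>h. h \<in> {h\<^sub>1..h\<^sub>2} \<Longrightarrow> \<bar>v h - 1\<bar> \<le> \<epsilon>"
      and R: "\<And>h. h \<in> {h\<^sub>1..h\<^sub>2} \<Longrightarrow> \<bar>f h - f 0 - q * s * h - \<tau> * h ^ 3\<bar> \<le> \<epsilon> * (\<bar>s\<bar> * \<bar>h\<bar> + \<bar>h\<bar> ^ 3)"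
    define l where "l = h\<^sub>2 - h\<^sub>1"
    define P where "P h = f 0 + q * s * h + \<tau> * h ^ 3" for h
    have l: "0 < l" using h by (simp add: l_def)
    have hl: "\<bar>x\<bar> \<le> l" "\<bar>x\<bar> ^ 3 \<le> l ^ 3" if "x \<in> {h\<^sub>1..h\<^sub>2}" for x
    proof -
      show "\<bar>x\<bar> \<le> l" using that h by (auto simp: l_def abs_le_iff)
      then show "\<bar>x\<bar> ^ 3 \<le> l ^ 3" by (intro power_mono) auto
    qed
    have R': "\<bar>f x - P x\<bar> \<le> \<epsilon> * (\<bar>s\<bar> * l + l ^ 3)" if "x \<in> {h\<^sub>1..h\<^sub>2}" for x
    proof -
      have "\<epsilon> * (\<bar>s\<bar> * \<bar>x\<bar> + \<bar>x\<bar> ^ 3) \<le> \<epsilon> * (\<bar>s\<bar> * l + l ^ 3)"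
        using hl[OF that] e by (intro mult_left_mono add_mono) auto
      with R[OF that] show ?thesis by (simp add: P_def algebra_simps)
    qed
    have h12: "h\<^sub>1 \<in> {h\<^sub>1..h\<^sub>2}" "h\<^sub>2 \<in> {h\<^sub>1..h\<^sub>2}" using h by auto
    have P12: "P h\<^sub>2 - P h\<^sub>1 = l * (q * s + \<tau> * (h\<^sub>2\<^sup>2 + h\<^sub>1 * h\<^sub>2 + h\<^sub>1\<^sup>2))"
      by (simp add: P_def l_def algebra_simps power2_eq_square power3_eq_cube)
    have s: "\<bar>s\<bar> \<le> K * l\<^sup>2"
    proof -
      have "\<bar>P h\<^sub>2 - P h\<^sub>1\<bar> \<le> 2 * \<epsilon> * (\<bar>s\<bar> * l + l ^ 3)"
        using R'[OF h12(1)] R'[OF h12(2)] f0 by linarith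
      also have "\<dots> = l * (2 * \<epsilon> * (\<bar>s\<bar> + l\<^sup>2))" by (simp add: algebra_simps power2_eq_square power3_eq_cube)
      finally have "\<bar>q * s + \<tau> * (h\<^sub>2\<^sup>2 + h\<^sub>1 * h\<^sub>2 + h\<^sub>1\<^sup>2)\<bar> \<le> 2 * \<epsilon> * (\<bar>s\<bar> + l\<^sup>2)"
        using l by (simp add: P12 abs_mult)
      also have "\<dots> \<le> q / 2 * (\<bar>s\<bar> + l\<^sup>2)" using e by (intro mult_right_mono) auto
      finally have 1: "\<bar>q * s + \<tau> * (h\<^sub>2\<^sup>2 + h\<^sub>1 * h\<^sub>2 + h\<^sub>1\<^sup>2)\<bar> \<le> q / 2 * \<bar>s\<bar> + q / 2 * l\<^sup>2" by (simp add: distrib_left)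
      have "h\<^sub>1 * h\<^sub>2 \<le> 0" using h by (simp add: mult_le_0_iff)
      then have "h\<^sub>2\<^sup>2 + h\<^sub>1 * h\<^sub>2 + h\<^sub>1\<^sup>2 \<le> l\<^sup>2" by (simp add: l_def power2_diff mult.commute)
      moreover have "0 \<le> h\<^sub>2\<^sup>2 + h\<^sub>1 * h\<^sub>2 + h\<^sub>1\<^sup>2"
        using sum_power2_ge_zero[of h\<^sub>1 h\<^sub>2] zero_le_power2[of "h\<^sub>1 + h\<^sub>2"] unfolding power2_sum by linarith
      ultimately have "\<bar>\<tau> * (h\<^sub>2\<^sup>2 + h\<^sub>1 * h\<^sub>2 + h\<^sub>1\<^sup>2)\<bar> \<le> \<tau> * l\<^sup>2"
        using \<tau> by (simp add: abs_mult)
      with 1 have "\<bar>q * s\<bar> \<le> \<tau> * l\<^sup>2 + q / 2 * \<bar>s\<bar> + q / 2 * l\<^sup>2" by linarith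
      then have "q * \<bar>s\<bar> \<le> q * (K * l\<^sup>2)"
        using q by (simp add: abs_mult K_def algebra_simps)
      then show ?thesis using q by simp
    qed
    have sl: "\<bar>s\<bar> * l \<le> K * l ^ 3" using mult_right_mono[OF s, of l] l by (simp add: power2_eq_square power3_eq_cube)
    have R'': "\<bar>f x - P x\<bar> \<le> \<epsilon> * (K + 1) * l ^ 3" if "x \<in> {h\<^sub>1..h\<^sub>2}" for x
    proof -
      have "\<epsilon> * (\<bar>s\<bar> * l + l ^ 3) \<le> \<epsilon> * (K * l ^ 3 + l ^ 3)" using sl e by (intro mult_left_mono) auto
      with R'[OF that] show ?thesis by (simp add: algebra_simps)
    qed
    have eK: "\<epsilon> * (K + 1) * l ^ 3 \<le> (K + 1) * l ^ 3"
      using e pos l by (intro mult_right_mono) (auto simp: mult_left_le_one_le)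
    have qs: "\<bar>q * s * x\<bar> \<le> q * K * l ^ 3" and tx: "\<bar>\<tau> * x ^ 3\<bar> \<le> \<tau> * l ^ 3" if "x \<in> {h\<^sub>1..h\<^sub>2}" for x
    proof -
      have "\<bar>s\<bar> * \<bar>x\<bar> \<le> \<bar>s\<bar> * l" using hl[OF that] by (intro mult_left_mono) auto
      with sl have "\<bar>s\<bar> * \<bar>x\<bar> \<le> K * l ^ 3" by linarith
      from mult_left_mono[OF this, of q] q show "\<bar>q * s * x\<bar> \<le> q * K * l ^ 3" by (simp add: abs_mult)
      show "\<bar>\<tau> * x ^ 3\<bar> \<le> \<tau> * l ^ 3" using hl[OF that] \<tau> by (simp add: abs_mult power_abs)
    qed
    have f0_bound: "\<bar>f 0\<bar> \<le> M\<^sub>0 * l ^ 3"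
      using R''[OF h12(1)] eK qs[OF h12(1)] tx[OF h12(1)] f0(1)
      by (simp add: P_def M\<^sub>0_def distrib_right)
    have f_bound: "\<bar>f x\<bar> \<le> M * l ^ 3" if "x \<in> {h\<^sub>1..h\<^sub>2}" for x
      using R''[OF that] eK qs[OF that] tx[OF that] f0_bound
      by (simp add: P_def M_def distrib_right)
    have intP: "(P has_integral
        (f 0 * h\<^sub>2 + q * s / 2 * h\<^sub>2\<^sup>2 + \<tau> / 4 * h\<^sub>2 ^ 4) - (f 0 * h\<^sub>1 + q * s / 2 * h\<^sub>1\<^sup>2 + \<tau> / 4 * h\<^sub>1 ^ 4)) {h\<^sub>1..h\<^sub>2}"
      (is "(P has_integral ?I) _")
      using h
      by (intro fundamental_theorem_of_calculus)
         (auto simp: P_def has_real_derivative_iff_has_vector_derivative[symmetric]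
            intro!: derivative_eq_intros)
    have "(\<lambda>x. v x * f x) integrable_on {h\<^sub>1..h\<^sub>2}"
      by (intro integrable_continuous_real continuous_on_mult cont)
    then have "((\<lambda>x. v x * f x) has_integral 0) {h\<^sub>1..h\<^sub>2}" using area by (metis integrable_integral)
    from has_integral_diff[OF intP this]
    have "((\<lambda>x. P x - v x * f x) has_integral ?I) (cbox h\<^sub>1 h\<^sub>2)" by simp
    moreover have "norm (P x - v x * f x) \<le> \<epsilon> * (K + 1 + M) * l ^ 3" if "x \<in> cbox h\<^sub>1 h\<^sub>2" for x
    proof -
      have x: "x \<in> {h\<^sub>1..h\<^sub>2}" using that by simp
      have "\<bar>(v x - 1) * f x\<bar> \<le> \<epsilon> * (M * l ^ 3)"
        unfolding abs_mult using v[OF x] f_bound[OF x] e by (intro mult_mono) auto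
      moreover have "P x - v x * f x = - (f x - P x) - (v x - 1) * f x" by (simp add: algebra_simps)
      ultimately show ?thesis using R''[OF x] by (simp add: algebra_simps)
    qed
    ultimately have "norm ?I \<le> \<epsilon> * (K + 1 + M) * l ^ 3 * measure lborel (cbox h\<^sub>1 h\<^sub>2)"
      using e pos l by (intro has_integral_bound) auto
    then have I: "\<bar>?I\<bar> \<le> \<epsilon> * (K + 1 + M) * l ^ 4" using h by (simp add: l_def eval_nat_numeral mult.assoc)
    \<comment> \<open>The trapezoidal rule minus the integral: only the cubic term contributes, in proportion to the asymmetry \<open>h\<^sub>1 + h\<^sub>2\<close>.\<close>
    have trapezoid: "\<tau> / 4 * (h\<^sub>1 + h\<^sub>2) * l ^ 3 = (P h\<^sub>1 + P h\<^sub>2) / 2 * l - ?I"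
      by (simp add: P_def l_def field_simps eval_nat_numeral)
    have "\<bar>h\<^sub>1 + h\<^sub>2\<bar> \<le> C\<^sub>1 * \<epsilon> * l"
    proof -
      have "\<bar>(P h\<^sub>1 + P h\<^sub>2) / 2\<bar> \<le> \<epsilon> * (K + 1) * l ^ 3"
        using R''[OF h12(1)] R''[OF h12(2)] f0 by simp
      then have "\<bar>(P h\<^sub>1 + P h\<^sub>2) / 2\<bar> * l \<le> \<epsilon> * (K + 1) * l ^ 3 * l"
        using l by (intro mult_right_mono) auto
      then have "\<bar>(P h\<^sub>1 + P h\<^sub>2) / 2 * l\<bar> \<le> \<epsilon> * (K + 1) * l ^ 4"
        using l unfolding abs_mult by (simp add: eval_nat_numeral mult.assoc)
      with I trapezoid have "\<bar>\<tau> / 4 * (h\<^sub>1 + h\<^sub>2) * l ^ 3\<bar> \<le> \<epsilon> * (K + 1) * l ^ 4 + \<epsilon> * (K + 1 + M) * l ^ 4"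
        by linarith
      also have "\<dots> = (\<tau> / 4 * (C\<^sub>1 * \<epsilon> * l)) * l ^ 3"
        using \<tau> by (simp add: C\<^sub>1_def field_simps eval_nat_numeral)
      finally have "\<bar>\<tau> / 4 * (h\<^sub>1 + h\<^sub>2)\<bar> * l ^ 3 \<le> (\<tau> / 4 * (C\<^sub>1 * \<epsilon> * l)) * l ^ 3"
        using l by (simp add: abs_mult)
      then have "\<bar>\<tau> / 4 * (h\<^sub>1 + h\<^sub>2)\<bar> \<le> \<tau> / 4 * (C\<^sub>1 * \<epsilon> * l)"
        using l by (simp only: mult_le_cancel_right) auto
      then show ?thesis using \<tau> by (simp add: abs_mult)
    qed
    moreover have "\<bar>h\<^sub>1 + h\<^sub>2\<bar> \<le> l" using h by (auto simp: l_def)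
    ultimately have "\<bar>h\<^sub>1 + h\<^sub>2\<bar> * \<bar>h\<^sub>1 + h\<^sub>2\<bar> \<le> (C\<^sub>1 * \<epsilon> * l) * l"
      using l by (intro mult_mono) auto
    then have sq: "(h\<^sub>1 + h\<^sub>2)\<^sup>2 \<le> C\<^sub>1 * \<epsilon> * l\<^sup>2" by (simp add: power2_eq_square mult.assoc)
    have "\<bar>P h\<^sub>2 - P h\<^sub>1\<bar> \<le> 2 * (\<epsilon> * (K + 1) * l ^ 3)"
      using R''[OF h12(1)] R''[OF h12(2)] f0 by linarith
    also have "\<dots> = l * (2 * (\<epsilon> * (K + 1) * l\<^sup>2))" by (simp add: eval_nat_numeral)
    finally have "\<bar>q * s + \<tau> * (h\<^sub>2\<^sup>2 + h\<^sub>1 * h\<^sub>2 + h\<^sub>1\<^sup>2)\<bar> \<le> 2 * (\<epsilon> * (K + 1) * l\<^sup>2)"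
      using l by (simp add: P12 abs_mult)
    moreover have "q * s + \<tau> * (h\<^sub>2\<^sup>2 + h\<^sub>1 * h\<^sub>2 + h\<^sub>1\<^sup>2) = q * s + \<tau> / 4 * l\<^sup>2 + 3 / 4 * \<tau> * (h\<^sub>1 + h\<^sub>2)\<^sup>2"
      by (simp add: l_def field_simps power2_eq_square)
    moreover have "0 \<le> 3 / 4 * \<tau> * (h\<^sub>1 + h\<^sub>2)\<^sup>2" "3 / 4 * \<tau> * (h\<^sub>1 + h\<^sub>2)\<^sup>2 \<le> 3 / 4 * \<tau> * (C\<^sub>1 * \<epsilon> * l\<^sup>2)"
      using \<tau> sq by (auto intro!: mult_left_mono)
    ultimately have "\<bar>q * s + \<tau> / 4 * l\<^sup>2\<bar> \<le> 2 * (\<epsilon> * (K + 1) * l\<^sup>2) + 3 / 4 * \<tau> * (C\<^sub>1 * \<epsilon> * l\<^sup>2)" by linarith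
    also have "\<dots> = (2 * (K + 1) + 3 / 4 * \<tau> * C\<^sub>1) * (\<epsilon> * l\<^sup>2)" by (simp add: algebra_simps)
    also have "\<dots> \<le> C * (\<epsilon> * l\<^sup>2)" using C e by (intro mult_right_mono) auto
    finally have "\<bar>q * s + \<tau> / 4 * l\<^sup>2\<bar> \<le> C * \<epsilon> * l\<^sup>2" by (simp add: mult.assoc)
    moreover have "M\<^sub>0 * l ^ 3 \<le> C * l ^ 3" using C l by (intro mult_right_mono) auto
    ultimately show "\<bar>f 0\<bar> \<le> C * (h\<^sub>2 - h\<^sub>1) ^ 3 \<and> \<bar>q * s + \<tau> / 4 * (h\<^sub>2 - h\<^sub>1)\<^sup>2\<bar> \<le> C * \<epsilon> * (h\<^sub>2 - h\<^sub>1)\<^sup>2"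
      using f0_bound by (simp add: l_def)
  qed
qed

text \<open>
  The asymptotic form of the preceding bounds: along a family of functions that is cubic to leading
  order, with zeros shrinking to \<open>0\<close> from both sides, dividing the weight by its value at \<open>0\<close> brings it
  within any \<open>\<epsilon>\<close> of \<open>1\<close>.
\<close>
lemma equal_area_cubic:
  fixes f :: "'p \<Rightarrow> real \<Rightarrow> real" and w :: "real \<Rightarrow> real"
  assumes q: "0 < q" and \<tau>: "0 < \<tau>"
    and w: "continuous_on UNIV w" "0 < w 0"
    and lim: "(h\<^sub>1 \<longlongrightarrow> 0) Fl" "(h\<^sub>2 \<longlongrightarrow> 0) Fl"
    and sgn: "\<forall>\<^sub>F p in Fl. h\<^sub>1 p < 0 \<and> 0 < h\<^sub>2 p"
    and zero: "\<forall>\<^sub>F p in Fl. f p (h\<^sub>1 p) = 0 \<and> f p (h\<^sub>2 p) = 0"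
    and cont: "\<forall>\<^sub>F p in Fl. continuous_on {h\<^sub>1 p..h\<^sub>2 p} (f p)"
    and area: "\<forall>\<^sub>F p in Fl. integral {h\<^sub>1 p..h\<^sub>2 p} (\<lambda>h. w h * f p h) = 0"
    and expansion: "\<And>\<epsilon>. 0 < \<epsilon> \<Longrightarrow> \<forall>\<^sub>F p in Fl. \<forall>h\<in>{h\<^sub>1 p..h\<^sub>2 p}.
      \<bar>f p h - f p 0 - q * s p * h - \<tau> * h ^ 3\<bar> \<le> \<epsilon> * (\<bar>s p\<bar> * \<bar>h\<bar> + \<bar>h\<bar> ^ 3)"
  shows "((\<lambda>p. s p / (h\<^sub>2 p - h\<^sub>1 p)\<^sup>2) \<longlongrightarrow> - \<tau> / (4 * q)) Fl"
    and "((\<lambda>p. f p 0 / (h\<^sub>2 p - h\<^sub>1 p)\<^sup>2) \<longlongrightarrow> 0) Fl"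
proof -
  define l where "l p = h\<^sub>2 p - h\<^sub>1 p" for p
  from equal_area_cubic_bounds[OF q \<tau>] obtain C where C: "0 < C"
    "\<And>f v :: real \<Rightarrow> real. \<And>h\<^sub>1 h\<^sub>2 s \<epsilon>. \<lbrakk>h\<^sub>1 < 0; 0 < h\<^sub>2; f h\<^sub>1 = 0; f h\<^sub>2 = 0; 0 < \<epsilon>; \<epsilon> \<le> 1; \<epsilon> \<le> q / 4;
       continuous_on {h\<^sub>1..h\<^sub>2} f; continuous_on {h\<^sub>1..h\<^sub>2} v;
       integral {h\<^sub>1..h\<^sub>2} (\<lambda>h. v h * f h) = 0;
       \<And>h. h \<in> {h\<^sub>1..h\<^sub>2} \<Longrightarrow> \<bar>v h - 1\<bar> \<le> \<epsilon>;
       \<And>h. h \<in> {h\<^sub>1..h\<^sub>2} \<Longrightarrow> \<bar>f h - f 0 - q * s * h - \<tau> * h ^ 3\<bar> \<le> \<epsilon> * (\<bar>s\<bar> * \<bar>h\<bar> + \<bar>h\<bar> ^ 3)\<rbrakk>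
     \<Longrightarrow> \<bar>f 0\<bar> \<le> C * (h\<^sub>2 - h\<^sub>1) ^ 3 \<and> \<bar>q * s + \<tau> / 4 * (h\<^sub>2 - h\<^sub>1)\<^sup>2\<bar> \<le> C * \<epsilon> * (h\<^sub>2 - h\<^sub>1)\<^sup>2"
    by blast
  have bounds: "\<forall>\<^sub>F p in Fl. 0 < l p \<and> \<bar>f p 0\<bar> \<le> C * l p ^ 3 \<and> \<bar>q * s p + \<tau> / 4 * (l p)\<^sup>2\<bar> \<le> C * \<epsilon> * (l p)\<^sup>2"
    if e: "0 < \<epsilon>" "\<epsilon> \<le> 1" "\<epsilon> \<le> q / 4" for \<epsilon>
  proof -
    have "isCont (\<lambda>h. w h / w 0) 0"
      using w by (intro continuous_intros) (auto simp: continuous_on_eq_continuous_at)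
    then obtain d where d: "0 < d" "\<And>h. \<bar>h\<bar> < d \<Longrightarrow> \<bar>w h / w 0 - 1\<bar> < \<epsilon>"
      using e(1) w(2) unfolding continuous_at_eps_delta by (auto simp: dist_real_def)
    have "\<forall>\<^sub>F p in Fl. \<bar>h\<^sub>1 p\<bar> < d" "\<forall>\<^sub>F p in Fl. \<bar>h\<^sub>2 p\<bar> < d"
      using lim d(1) by (auto simp: tendsto_iff dist_real_def)
    with sgn zero cont area expansion[OF e(1)] show ?thesis
    proof eventually_elim
      case (elim p)
      have "\<bar>f p 0\<bar> \<le> C * (h\<^sub>2 p - h\<^sub>1 p) ^ 3 \<and>
        \<bar>q * s p + \<tau> / 4 * (h\<^sub>2 p - h\<^sub>1 p)\<^sup>2\<bar> \<le> C * \<epsilon> * (h\<^sub>2 p - h\<^sub>1 p)\<^sup>2"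
      proof (rule C(2)[where v = "\<lambda>h. w h / w 0"])
        have "continuous_on {h\<^sub>1 p..h\<^sub>2 p} w" using w(1) continuous_on_subset by blast
        then show "continuous_on {h\<^sub>1 p..h\<^sub>2 p} (\<lambda>h. w h / w 0)"
          using w(2) by (intro continuous_intros) auto
        have "integral {h\<^sub>1 p..h\<^sub>2 p} (\<lambda>h. w h / w 0 * f p h) = integral {h\<^sub>1 p..h\<^sub>2 p} (\<lambda>h. w h * f p h / w 0)"
          by simp
        also have "\<dots> = 0" using elim by (subst integral_divide) simp
        finally show "integral {h\<^sub>1 p..h\<^sub>2 p} (\<lambda>h. w h / w 0 * f p h) = 0" .
        show "\<bar>w h / w 0 - 1\<bar> \<le> \<epsilon>" if "h \<in> {h\<^sub>1 p..h\<^sub>2 p}" for h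
          using that elim by (intro less_imp_le d(2)) (auto simp: abs_less_iff)
      qed (use elim e in auto)
      then show ?case using elim by (simp add: l_def)
    qed
  qed
  define e0 where "e0 = min 1 (q / 4)"
  have e0: "0 < e0" "e0 \<le> 1" "e0 \<le> q / 4" using q by (auto simp: e0_def)
  have "((\<lambda>p. q * s p / (l p)\<^sup>2 + \<tau> / 4) \<longlongrightarrow> 0) Fl"
  proof (rule tendstoI)
    fix \<epsilon> :: real assume "0 < \<epsilon>"
    define e' where "e' = min e0 (\<epsilon> / (2 * C))"
    have e': "0 < e'" "e' \<le> 1" "e' \<le> q / 4" "C * e' < \<epsilon>"
    proof -
      show "0 < e'" "e' \<le> 1" "e' \<le> q / 4" using e0 \<open>0 < \<epsilon>\<close> C(1) by (auto simp: e'_def)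
      have "C * e' \<le> C * (\<epsilon> / (2 * C))" using C(1) by (intro mult_left_mono) (auto simp: e'_def)
      also have "\<dots> < \<epsilon>" using C(1) \<open>0 < \<epsilon>\<close> by simp
      finally show "C * e' < \<epsilon>" .
    qed
    from bounds[OF e'(1-3)] show "\<forall>\<^sub>F p in Fl. dist (q * s p / (l p)\<^sup>2 + \<tau> / 4) 0 < \<epsilon>"
    proof eventually_elim
      case (elim p)
      then have "q * s p / (l p)\<^sup>2 + \<tau> / 4 = (q * s p + \<tau> / 4 * (l p)\<^sup>2) / (l p)\<^sup>2"
        by (simp add: add_divide_distrib)
      then have "\<bar>q * s p / (l p)\<^sup>2 + \<tau> / 4\<bar> = \<bar>q * s p + \<tau> / 4 * (l p)\<^sup>2\<bar> / (l p)\<^sup>2"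
        by simp
      also have "\<dots> \<le> C * e' * (l p)\<^sup>2 / (l p)\<^sup>2" using elim by (intro divide_right_mono) auto
      also have "\<dots> = C * e'" using elim by simp
      finally show ?case using e'(4) by simp
    qed
  qed
  from tendsto_mult[OF tendsto_diff[OF this tendsto_const[of "\<tau> / 4"]] tendsto_const[of "1 / q"]]
  show "((\<lambda>p. s p / (h\<^sub>2 p - h\<^sub>1 p)\<^sup>2) \<longlongrightarrow> - \<tau> / (4 * q)) Fl"
    using q by (simp add: l_def)
  have "(l \<longlongrightarrow> 0) Fl" using tendsto_diff[OF lim(2) lim(1)] by (simp add: l_def[abs_def])
  then have "((\<lambda>p. C * l p) \<longlongrightarrow> 0) Fl" using tendsto_mult_right_zero by blast
  moreover from bounds[OF e0] have "\<forall>\<^sub>F p in Fl. norm (f p 0 / (l p)\<^sup>2) \<le> C * l p"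
  proof eventually_elim
    case (elim p)
    then have "\<bar>f p 0\<bar> / (l p)\<^sup>2 \<le> C * l p ^ 3 / (l p)\<^sup>2" by (intro divide_right_mono) auto
    also have "\<dots> = C * l p" using elim by (simp add: eval_nat_numeral)
    finally show ?case by simp
  qed
  ultimately show "((\<lambda>p. f p 0 / (h\<^sub>2 p - h\<^sub>1 p)\<^sup>2) \<longlongrightarrow> 0) Fl"
    unfolding l_def by (rule Lim_null_comparison[rotated])
qed

section \<open>First-order conditions for optimizers\<close>

lemma optimizer_le:
  assumes "0 < \<rho>" "0 < \<beta>" "optimizer \<rho> \<beta> a" "ln \<rho> < x"
  shows "objective \<rho> \<beta> x \<le> objective \<rho> \<beta> a"
proof -
  have "objective \<rho> \<beta> x \<le> lyapunov \<rho> \<beta>"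
    unfolding lyapunov_def using assms by (intro cSUP_upper bdd_above_objective) auto
  then show ?thesis using assms by (simp add: optimizer_def)
qed

lemma optimizer_imp_F:
  assumes "0 < \<rho>" "0 < \<beta>" "optimizer \<rho> \<beta> a"
  shows "F a \<rho> = 2 * sqrt \<beta>"
proof -
  have a: "ln \<rho> < a" using assms by (simp add: optimizer_def)
  have "(objective \<rho> \<beta> has_real_derivative logistic a * (1 - F a \<rho> / (2 * sqrt \<beta>))) (at a)"
    using DERIV_objective[OF a, of \<beta>] assms(1) by simp
  moreover have "0 < a - ln \<rho>" using a by simp
  moreover have "\<forall>y. \<bar>a - y\<bar> < a - ln \<rho> \<longrightarrow> objective \<rho> \<beta> y \<le> objective \<rho> \<beta> a"
    using optimizer_le[OF assms] by (auto simp: abs_less_iff)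
  ultimately have "logistic a * (1 - F a \<rho> / (2 * sqrt \<beta>)) = 0" by (rule DERIV_local_max)
  then show ?thesis using logistic_pos[of a] assms(2) by simp
qed

text \<open>
  The equal-area rule: the integrand is, up to the factor \<open>- 2 * sqrt \<beta>\<close>, the derivative of the
  objective, whose values at the two optimizers coincide.
\<close>
lemma optimizers_equal_area:
  assumes "0 < \<rho>" "0 < \<beta>" "optimizer \<rho> \<beta> a\<^sub>1" "optimizer \<rho> \<beta> a\<^sub>2" "a\<^sub>1 < a\<^sub>2"
  shows "integral {a\<^sub>1 - c..a\<^sub>2 - c} (\<lambda>h. logistic (c + h) * (F (c + h) \<rho> - 2 * sqrt \<beta>)) = 0"
proof (rule integral_unique)
  let ?J = "\<lambda>h. - 2 * sqrt \<beta> * objective \<rho> \<beta> (h + c)"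
  have "(?J has_vector_derivative logistic (c + h) * (F (c + h) \<rho> - 2 * sqrt \<beta>)) (at h within {a\<^sub>1 - c..a\<^sub>2 - c})"
    if "h \<in> {a\<^sub>1 - c..a\<^sub>2 - c}" for h
  proof -
    have "ln \<rho> < c + h" using that assms(3) by (auto simp: optimizer_def)
    from DERIV_objective[OF this, of \<beta>] assms(1)
    have "(objective \<rho> \<beta> has_real_derivative logistic (c + h) * (1 - F (c + h) \<rho> / (2 * sqrt \<beta>))) (at (h + c))"
      by (simp add: add.commute)
    then have "((\<lambda>h. objective \<rho> \<beta> (h + c)) has_real_derivative logistic (c + h) * (1 - F (c + h) \<rho> / (2 * sqrt \<beta>))) (at h)"
      by (simp only: DERIV_shift)
    from DERIV_cmult[OF this, of "- 2 * sqrt \<beta>"]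
    moreover have "- 2 * sqrt \<beta> * (logistic (c + h) * (1 - F (c + h) \<rho> / (2 * sqrt \<beta>))) =
        logistic (c + h) * (F (c + h) \<rho> - 2 * sqrt \<beta>)"
      using assms(2) by (simp add: field_simps)
    ultimately have "(?J has_real_derivative logistic (c + h) * (F (c + h) \<rho> - 2 * sqrt \<beta>)) (at h)"
      by simp
    then show ?thesis
      by (auto simp: has_real_derivative_iff_has_vector_derivative intro: has_vector_derivative_at_within)
  qed
  then have "((\<lambda>h. logistic (c + h) * (F (c + h) \<rho> - 2 * sqrt \<beta>)) has_integral ?J (a\<^sub>2 - c) - ?J (a\<^sub>1 - c))
      {a\<^sub>1 - c..a\<^sub>2 - c}"
    using assms(5) by (intro fundamental_theorem_of_calculus) auto
  then show "((\<lambda>h. logistic (c + h) * (F (c + h) \<rho> - 2 * sqrt \<beta>)) has_integral 0) {a\<^sub>1 - c..a\<^sub>2 - c}"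
    using assms(3,4) by (simp add: optimizer_def)
qed


section \<open>Power laws along the phase transition curve\<close>

text \<open>
  Without this the limit along the curve could be vacuous, and every exponent would be critical.
\<close>
lemma curve_end_point_not_isolated:
  assumes "smooth_curve_ending_at C p"
  shows "at p within C \<noteq> bot"
proof -
  obtain x y :: "real \<Rightarrow> real" where C: "C = (\<lambda>t. (x t, y t)) ` {0<..<1}" "p \<notin> C"
    "((\<lambda>t. (x t, y t)) \<longlongrightarrow> p) (at_right 0)"
    using assms unfolding smooth_curve_ending_at_def by blast
  have "\<forall>\<^sub>F t::real in at_right 0. t \<in> {0<..<1}"
    by (rule eventually_at_right_real) simp
  then have "\<forall>\<^sub>F t in at_right 0. (x t, y t) \<in> C \<and> (x t, y t) \<noteq> p"
    by eventually_elim (use C(1,2) in auto)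
  with C(3) have "filterlim (\<lambda>t. (x t, y t)) (at p within C) (at_right 0)"
    by (simp add: filterlim_at)
  then show ?thesis by (auto simp: filterlim_def filtermap_bot_iff bot_unique)
qed

text \<open>
  The quotient of the two power laws tends to \<open>1\<close>, but to \<open>0\<close> if \<open>\<alpha>' > \<alpha>\<close>.  Uniqueness of the
  exponent follows by symmetry.
\<close>
lemma power_law_exponent_le:
  fixes b l :: "'p \<Rightarrow> real"
  assumes Fl: "Fl \<noteq> bot" and b: "(b \<longlongrightarrow> 0) Fl" "\<forall>\<^sub>F p in Fl. b p \<noteq> 0"
    and l: "l \<sim>[Fl] (\<lambda>p. c * \<bar>b p\<bar> powr \<alpha>)" "l \<sim>[Fl] (\<lambda>p. c' * \<bar>b p\<bar> powr \<alpha>')"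
    and c: "c \<noteq> 0"
  shows "\<alpha>' \<le> \<alpha>"
proof (rule ccontr)
  assume "\<not> \<alpha>' \<le> \<alpha>"
  then have "((\<lambda>p. \<bar>b p\<bar> powr (\<alpha>' - \<alpha>)) \<longlongrightarrow> 0) Fl"
    using b(1) by (intro tendsto_zero_powrI[of _ _ _ "\<alpha>' - \<alpha>"]) (auto intro: tendsto_rabs_zero)
  from tendsto_mult_right_zero[OF this, of "c' / c"]
  have "((\<lambda>p. c' / c * \<bar>b p\<bar> powr (\<alpha>' - \<alpha>)) \<longlongrightarrow> 0) Fl" .
  moreover have "((\<lambda>p. c' / c * \<bar>b p\<bar> powr (\<alpha>' - \<alpha>)) \<longlongrightarrow> 1) Fl"
  proof -
    have "(\<lambda>p. c' * \<bar>b p\<bar> powr \<alpha>') \<sim>[Fl] (\<lambda>p. c * \<bar>b p\<bar> powr \<alpha>)"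
      using asymp_equiv_trans[OF asymp_equiv_symI[OF l(2)] l(1)] .
    then have "((\<lambda>p. (c' * \<bar>b p\<bar> powr \<alpha>') / (c * \<bar>b p\<bar> powr \<alpha>)) \<longlongrightarrow> 1) Fl"
      by (rule asymp_equivD_strong) (use b(2) c in \<open>auto elim: eventually_mono\<close>)
    then show ?thesis by (simp add: powr_diff)
  qed
  ultimately show False using Fl tendsto_unique by fastforce
qed

lemma square_root_law:
  fixes b l :: "'p \<Rightarrow> real"
  assumes "((\<lambda>p. b p / (l p)\<^sup>2) \<longlongrightarrow> \<kappa>) Fl" "0 < \<kappa>" "\<forall>\<^sub>F p in Fl. 0 < l p"
  shows "l \<sim>[Fl] (\<lambda>p. sqrt (1 / \<kappa>) * \<bar>b p\<bar> powr (1/2))"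
proof -
  have "((\<lambda>p. sqrt (1 / \<bar>b p / (l p)\<^sup>2\<bar>)) \<longlongrightarrow> sqrt (1 / \<bar>\<kappa>\<bar>)) Fl"
    using assms(1,2) by (intro tendsto_intros) auto
  moreover have "\<forall>\<^sub>F p in Fl. sqrt (1 / \<bar>b p / (l p)\<^sup>2\<bar>) = l p / \<bar>b p\<bar> powr (1/2)"
    using assms(3) by eventually_elim (simp add: powr_half_sqrt real_sqrt_divide)
  ultimately have "((\<lambda>p. l p / \<bar>b p\<bar> powr (1/2)) \<longlongrightarrow> sqrt (1 / \<bar>\<kappa>\<bar>)) Fl"
    by (rule Lim_transform_eventually)
  then show ?thesis using assms(2) by (intro asymp_equivI'_const) auto
qed

theorem mainTheorem8:
  fixes \<rho>\<^sub>c a\<^sub>c \<beta>\<^sub>c :: real and a\<^sub>1 a\<^sub>2 :: "real \<times> real \<Rightarrow> real"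
  assumes "critical_point \<rho>\<^sub>c a\<^sub>c \<beta>\<^sub>c"
    and "(deriv ^^ 2) (\<lambda>a. F a \<rho>\<^sub>c) a\<^sub>c = 0"
    and "(deriv ^^ 3) (\<lambda>a. F a \<rho>\<^sub>c) a\<^sub>c > 0"
    and "smooth_curve_ending_at phase_transition_curve (\<rho>\<^sub>c, \<beta>\<^sub>c)"
    and "\<And>\<rho> \<beta>. (\<rho>, \<beta>) \<in> phase_transition_curve \<Longrightarrow>
           a\<^sub>1 (\<rho>, \<beta>) < a\<^sub>2 (\<rho>, \<beta>) \<and> optimizer \<rho> \<beta> (a\<^sub>1 (\<rho>, \<beta>)) \<and> optimizer \<rho> \<beta> (a\<^sub>2 (\<rho>, \<beta>))"
    and "\<forall>\<^sub>F p in at (\<rho>\<^sub>c, \<beta>\<^sub>c) within phase_transition_curve. a\<^sub>1 p < a\<^sub>c \<and> a\<^sub>c < a\<^sub>2 p"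
    and "(a\<^sub>1 \<longlongrightarrow> a\<^sub>c) (at (\<rho>\<^sub>c, \<beta>\<^sub>c) within phase_transition_curve)"
    and "(a\<^sub>2 \<longlongrightarrow> a\<^sub>c) (at (\<rho>\<^sub>c, \<beta>\<^sub>c) within phase_transition_curve)"
  shows "(\<lambda>p. a\<^sub>2 p - a\<^sub>1 p) \<sim>[at (\<rho>\<^sub>c, \<beta>\<^sub>c) within phase_transition_curve]
           (\<lambda>p. 2 * D\<^sub>c \<rho>\<^sub>c a\<^sub>c
                 * sqrt (\<rho>\<^sub>c / sqrt \<beta>\<^sub>c * sqrt (ln ((1 + exp a\<^sub>c) / (1 + \<rho>\<^sub>c))))
                 * \<bar>snd p - \<beta>\<^sub>c\<bar> powr (1/2)) \<and>
         (\<forall>\<alpha>. is_critical_exponent \<rho>\<^sub>c \<beta>\<^sub>c a\<^sub>1 a\<^sub>2 \<alpha> \<longleftrightarrow> \<alpha> = 1/2)"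
proof -
  define Fl where "Fl = at (\<rho>\<^sub>c, \<beta>\<^sub>c) within phase_transition_curve"
  define r\<^sub>c where "r\<^sub>c = ln \<rho>\<^sub>c"
  define g where "g = softplus a\<^sub>c - softplus r\<^sub>c"
  define T where "T = (deriv ^^ 3) (\<lambda>a. F a \<rho>\<^sub>c) a\<^sub>c"
  define q where "q = logistic a\<^sub>c / 2 * g powr (-3/2)"
  define \<tau> where "\<tau> = T / 6"
  define s where "s p = ln (fst p) - r\<^sub>c" for p :: "real \<times> real"
  define l where "l p = a\<^sub>2 p - a\<^sub>1 p" for p
  define f where "f p h = F (a\<^sub>c + h) (fst p) - 2 * sqrt (snd p)" for p h
  note crit = assms(1)[unfolded critical_point_def]
  have \<rho>\<^sub>c: "0 < \<rho>\<^sub>c"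
  proof -
    obtain \<rho> where "\<rho> \<in> nonmonotone_rhos" using crit by auto
    then have "0 < \<rho>" "\<rho> \<le> \<rho>\<^sub>c" using crit by (auto simp: nonmonotone_rhos_def intro: cSup_upper)
    then show ?thesis by simp
  qed
  have c: "exp r\<^sub>c = \<rho>\<^sub>c" "r\<^sub>c < a\<^sub>c" "0 < \<beta>\<^sub>c" "2 * sqrt \<beta>\<^sub>c = F a\<^sub>c \<rho>\<^sub>c"
    "deriv (\<lambda>a. F a \<rho>\<^sub>c) a\<^sub>c = 0"
    using crit \<rho>\<^sub>c by (auto simp: r\<^sub>c_def)
  have g: "0 < g" using c by (simp add: g_def)
  have T: "0 < T" "0 < \<tau>" using assms(3) by (auto simp: T_def \<tau>_def)
  have q: "0 < q" using g logistic_pos[of a\<^sub>c] by (simp add: q_def)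
  have Fl: "Fl \<noteq> bot" unfolding Fl_def by (rule curve_end_point_not_isolated[OF assms(4)])
  have lim_p: "(fst \<longlongrightarrow> \<rho>\<^sub>c) Fl" "(snd \<longlongrightarrow> \<beta>\<^sub>c) Fl"
    unfolding Fl_def by (auto intro!: tendsto_eq_intros)
  have lim_r: "((\<lambda>p. ln (fst p)) \<longlongrightarrow> r\<^sub>c) Fl"
    using lim_p(1) \<rho>\<^sub>c unfolding r\<^sub>c_def by (intro tendsto_ln) auto
  then have lim_s: "(s \<longlongrightarrow> 0) Fl" unfolding s_def[abs_def] by (auto intro: tendsto_eq_intros)
  have curve: "\<forall>\<^sub>F p in Fl. 0 < fst p \<and> 0 < snd p \<and> a\<^sub>1 p < a\<^sub>2 p \<and>
      optimizer (fst p) (snd p) (a\<^sub>1 p) \<and> optimizer (fst p) (snd p) (a\<^sub>2 p)"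
    unfolding Fl_def eventually_at_filter
    using assms(5) by (intro always_eventually) (auto simp: phase_transition_curve_def)
  then have l_pos: "\<forall>\<^sub>F p in Fl. 0 < l p" by eventually_elim (simp add: l_def)
  have lim_a: "((\<lambda>p. a\<^sub>1 p - a\<^sub>c) \<longlongrightarrow> 0) Fl" "((\<lambda>p. a\<^sub>2 p - a\<^sub>c) \<longlongrightarrow> 0) Fl"
    using assms(7,8) by (auto simp: Fl_def LIM_zero)
  have width: "(a\<^sub>2 p - a\<^sub>c) - (a\<^sub>1 p - a\<^sub>c) = l p" for p by (simp add: l_def)
  have cont_w: "continuous_on UNIV (\<lambda>h. logistic (a\<^sub>c + h))"
    unfolding logistic_def using one_plus_exp_pos by (intro continuous_intros) (auto simp: less_imp_neq[symmetric])
  have pos_w: "0 < logistic (a\<^sub>c + 0)" by (rule logistic_pos)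
  have sides: "\<forall>\<^sub>F p in Fl. a\<^sub>1 p - a\<^sub>c < 0 \<and> 0 < a\<^sub>2 p - a\<^sub>c"
    using assms(6) unfolding Fl_def by eventually_elim auto
  have zeros: "\<forall>\<^sub>F p in Fl. f p (a\<^sub>1 p - a\<^sub>c) = 0 \<and> f p (a\<^sub>2 p - a\<^sub>c) = 0"
    using curve by eventually_elim (auto simp: f_def optimizer_imp_F)
  have cont_f: "\<forall>\<^sub>F p in Fl. continuous_on {a\<^sub>1 p - a\<^sub>c..a\<^sub>2 p - a\<^sub>c} (f p)"
    using curve
  proof eventually_elim
    case (elim p)
    have "continuous_on {ln (fst p)<..} (\<lambda>a. F a (exp (ln (fst p))))"
      using times_differentiable_on_DERIV_deriv[OF times_differentiable_on_F]
      by (intro DERIV_continuous_on) (auto intro: has_field_derivative_at_within)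
    then have F: "continuous_on {ln (fst p)<..} (\<lambda>a. F a (fst p))" using elim by simp
    show ?case unfolding f_def[abs_def]
      by (intro continuous_intros continuous_on_compose2[OF F]) (use elim in \<open>auto simp: optimizer_def\<close>)
  qed
  have area: "\<forall>\<^sub>F p in Fl. integral {a\<^sub>1 p - a\<^sub>c..a\<^sub>2 p - a\<^sub>c} (\<lambda>h. logistic (a\<^sub>c + h) * f p h) = 0"
    using curve by eventually_elim (auto simp: f_def intro: optimizers_equal_area)
  have expansion: "\<forall>\<^sub>F p in Fl. \<forall>h\<in>{a\<^sub>1 p - a\<^sub>c..a\<^sub>2 p - a\<^sub>c}.
      \<bar>f p h - f p 0 - q * s p * h - \<tau> * h ^ 3\<bar> \<le> \<epsilon> * (\<bar>s p\<bar> * \<bar>h\<bar> + \<bar>h\<bar> ^ 3)" if "0 < \<epsilon>" for \<epsilon>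
  proof -
    have "\<exists>d>0. \<forall>h r. \<bar>h\<bar> < d \<longrightarrow> \<bar>r - r\<^sub>c\<bar> < d \<longrightarrow>
      \<bar>F (a\<^sub>c + h) (exp r) - F a\<^sub>c (exp r) - q * (r - r\<^sub>c) * h - \<tau> * h ^ 3\<bar> \<le> \<epsilon> * (\<bar>r - r\<^sub>c\<bar> * \<bar>h\<bar> + \<bar>h\<bar> ^ 3)"
      using F_expansion[OF c(2), of \<epsilon>, unfolded c(1), OF c(5) assms(2) that, folded g_def T_def, folded q_def \<tau>_def] .
    then obtain d where d: "0 < d" "\<And>h r. \<bar>h\<bar> < d \<Longrightarrow> \<bar>r - r\<^sub>c\<bar> < d \<Longrightarrow>
      \<bar>F (a\<^sub>c + h) (exp r) - F a\<^sub>c (exp r) - q * (r - r\<^sub>c) * h - \<tau> * h ^ 3\<bar> \<le> \<epsilon> * (\<bar>r - r\<^sub>c\<bar> * \<bar>h\<bar> + \<bar>h\<bar> ^ 3)"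
      by blast
    have "\<forall>\<^sub>F p in Fl. \<bar>a\<^sub>1 p - a\<^sub>c\<bar> < d" "\<forall>\<^sub>F p in Fl. \<bar>a\<^sub>2 p - a\<^sub>c\<bar> < d" "\<forall>\<^sub>F p in Fl. \<bar>s p\<bar> < d"
      using lim_a lim_s d(1) by (auto simp: tendsto_iff dist_real_def)
    with curve show ?thesis
    proof eventually_elim
      case (elim p)
      show ?case
      proof
        fix h assume "h \<in> {a\<^sub>1 p - a\<^sub>c..a\<^sub>2 p - a\<^sub>c}"
        then have "\<bar>h\<bar> < d" using elim by (auto simp: abs_less_iff)
        from d(2)[OF this, of "ln (fst p)"] elim
        show "\<bar>f p h - f p 0 - q * s p * h - \<tau> * h ^ 3\<bar> \<le> \<epsilon> * (\<bar>s p\<bar> * \<bar>h\<bar> + \<bar>h\<bar> ^ 3)"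
          by (simp add: f_def s_def)
      qed
    qed
  qed
  note equal_area = equal_area_cubic[where w = "\<lambda>h. logistic (a\<^sub>c + h)" and f = f and s = s,
      OF q T(2) cont_w pos_w lim_a sides zeros cont_f area expansion, unfolded width]
  \<comment> \<open>The limit of \<open>(\<beta> - \<beta>\<^sub>c) / (a\<^sub>2 - a\<^sub>1)\<^sup>2\<close> along the curve.\<close>
  define \<kappa> where "\<kappa> = \<tau> * sqrt \<beta>\<^sub>c / (sqrt g * (4 * q))"
  have \<kappa>: "0 < \<kappa>" using q T g c by (simp add: \<kappa>_def)
  \<comment> \<open>Since \<open>f p 0 = F a\<^sub>c \<rho> - 2 * sqrt \<beta>\<close> is negligible, \<open>2 * sqrt \<beta>\<close> moves like \<open>F a\<^sub>c \<rho>\<close>, that is linearly in \<open>s\<close>; the factor \<open>(sqrt \<beta> + sqrt \<beta>\<^sub>c) / 2\<close> then converts to \<open>\<beta> - \<beta>\<^sub>c\<close>.\<close>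
  have b_lim: "((\<lambda>p. (snd p - \<beta>\<^sub>c) / (l p)\<^sup>2) \<longlongrightarrow> \<kappa>) Fl"
  proof -
    have "((\<lambda>r. F a\<^sub>c (exp r)) has_real_derivative - (1 / sqrt g)) (at r\<^sub>c)"
      using DERIV_F_ln_rho[OF c(2)] by (simp add: g_def)
    \<comment> \<open>Caratheodory: the increment of \<open>F a\<^sub>c\<close> is exactly \<open>\<phi> r * (r - r\<^sub>c)\<close> with \<open>\<phi>\<close> continuous at \<open>r\<^sub>c\<close>.\<close>
    then obtain \<phi> where \<phi>: "\<And>r. F a\<^sub>c (exp r) - F a\<^sub>c (exp r\<^sub>c) = \<phi> r * (r - r\<^sub>c)" "isCont \<phi> r\<^sub>c" "\<phi> r\<^sub>c = - (1 / sqrt g)"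
      unfolding CARAT_DERIV by blast
    have "((\<lambda>p. \<phi> (ln (fst p))) \<longlongrightarrow> - (1 / sqrt g)) Fl"
      using isCont_tendsto_compose[OF \<phi>(2) lim_r] \<phi>(3) by simp
    from tendsto_mult[OF tendsto_diff[OF tendsto_mult[OF this equal_area(1)] equal_area(2)]
        tendsto_divide[OF tendsto_add[OF tendsto_real_sqrt[OF lim_p(2)] tendsto_const[of "sqrt \<beta>\<^sub>c"]] tendsto_const[of "2::real"]]]
    have "((\<lambda>p. (\<phi> (ln (fst p)) * (s p / (l p)\<^sup>2) - f p 0 / (l p)\<^sup>2) * ((sqrt (snd p) + sqrt \<beta>\<^sub>c) / 2)) \<longlongrightarrow> \<kappa>) Fl"
      using q g by (simp add: \<kappa>_def)
    moreover have "\<forall>\<^sub>F p in Fl. (\<phi> (ln (fst p)) * (s p / (l p)\<^sup>2) - f p 0 / (l p)\<^sup>2) * ((sqrt (snd p) + sqrt \<beta>\<^sub>c) / 2)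
        = (snd p - \<beta>\<^sub>c) / (l p)\<^sup>2"
      using curve
    proof eventually_elim
      case (elim p)
      have "\<phi> (ln (fst p)) * s p - f p 0 = 2 * (sqrt (snd p) - sqrt \<beta>\<^sub>c)"
        using \<phi>(1)[of "ln (fst p)"] elim c by (simp add: f_def s_def)
      moreover have "(sqrt (snd p) - sqrt \<beta>\<^sub>c) * (sqrt (snd p) + sqrt \<beta>\<^sub>c) = snd p - \<beta>\<^sub>c"
        using elim c(3) by (simp add: algebra_simps)
      ultimately have "(\<phi> (ln (fst p)) * s p - f p 0) * ((sqrt (snd p) + sqrt \<beta>\<^sub>c) / 2) = snd p - \<beta>\<^sub>c"
        by algebra
      then show ?case by (metis diff_divide_distrib times_divide_eq_left times_divide_eq_right)
    qed
    ultimately show ?thesis by (rule Lim_transform_eventually)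
  qed
  define K where "K = 2 * D\<^sub>c \<rho>\<^sub>c a\<^sub>c * sqrt (\<rho>\<^sub>c / sqrt \<beta>\<^sub>c * sqrt (ln ((1 + exp a\<^sub>c) / (1 + \<rho>\<^sub>c))))"
  have K: "K = sqrt (1 / \<kappa>)"
  proof -
    have "ln ((1 + exp a\<^sub>c) / (1 + \<rho>\<^sub>c)) = g"
      using ln_ratio_softplus[of a\<^sub>c r\<^sub>c] c(1) by (simp add: g_def)
    then have "K = sqrt 4 * sqrt (1 / g powr (3/2) * (3 * exp a\<^sub>c / (\<rho>\<^sub>c * (1 + exp a\<^sub>c))) * (1 / T)) *
        sqrt (\<rho>\<^sub>c / sqrt \<beta>\<^sub>c * sqrt g)"
      by (simp add: K_def D\<^sub>c_def T_def)
    also have "\<dots> = sqrt (4 * (1 / g powr (3/2) * (3 * exp a\<^sub>c / (\<rho>\<^sub>c * (1 + exp a\<^sub>c))) * (1 / T)) *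
        (\<rho>\<^sub>c / sqrt \<beta>\<^sub>c * sqrt g))"
      by (simp only: real_sqrt_mult)
    also have "4 * (1 / g powr (3/2) * (3 * exp a\<^sub>c / (\<rho>\<^sub>c * (1 + exp a\<^sub>c))) * (1 / T)) *
        (\<rho>\<^sub>c / sqrt \<beta>\<^sub>c * sqrt g) = 1 / \<kappa>"
    proof -
      have 1: "3 * exp a\<^sub>c / (\<rho>\<^sub>c * (1 + exp a\<^sub>c)) = 3 * logistic a\<^sub>c / \<rho>\<^sub>c"
        by (simp add: logistic_def)
      have 2: "q = logistic a\<^sub>c / (2 * g powr (3/2))"
        using powr_minus_divide[of g "3/2"] by (simp add: q_def)
      have "0 < g powr (3/2)" "0 < sqrt \<beta>\<^sub>c" "0 < sqrt g" using g c(3) by auto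
      then show ?thesis
        unfolding 1 \<kappa>_def \<tau>_def 2 using T(1) \<rho>\<^sub>c logistic_pos[of a\<^sub>c]
        by (simp add: divide_simps)
    qed
    finally show ?thesis .
  qed
  have main: "l \<sim>[Fl] (\<lambda>p. K * \<bar>snd p - \<beta>\<^sub>c\<bar> powr (1/2))"
    unfolding K by (rule square_root_law[OF b_lim \<kappa> l_pos])
  have "\<forall>\<^sub>F p in Fl. 0 < (snd p - \<beta>\<^sub>c) / (l p)\<^sup>2"
    using b_lim \<kappa> by (rule order_tendstoD)
  then have b_nz: "\<forall>\<^sub>F p in Fl. snd p - \<beta>\<^sub>c \<noteq> 0" by eventually_elim auto
  have b_0: "((\<lambda>p. snd p - \<beta>\<^sub>c) \<longlongrightarrow> 0) Fl" using lim_p(2) by (simp add: LIM_zero)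
  have K0: "K \<noteq> 0" using K \<kappa> by simp
  have "\<alpha> = 1/2" if \<gamma>: "l \<sim>[Fl] (\<lambda>p. \<gamma> * \<bar>snd p - \<beta>\<^sub>c\<bar> powr \<alpha>)" for \<alpha> \<gamma>
  proof -
    have "\<gamma> \<noteq> 0"
    proof
      assume "\<gamma> = 0"
      then have "\<forall>\<^sub>F p in Fl. l p = 0" using \<gamma> asymp_equiv_eventually_zeros[OF \<gamma>] by simp
      with l_pos have "\<forall>\<^sub>F p in Fl. False" by eventually_elim simp
      then show False using Fl by simp
    qed
    then show ?thesis
      using power_law_exponent_le[OF Fl b_0 b_nz main \<gamma> K0]
        power_law_exponent_le[OF Fl b_0 b_nz \<gamma> main] by simp
  qed
  then show ?thesis
    using main unfolding is_critical_exponent_def Fl_def l_def[abs_def] K_def by blast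
qed

end
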